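(* Let $m,t$ be positive integers such that $t$ divides $m$, let $\theta:\mathbb{D}^2\to\theta(\mathbb{D}^2)$ be the basic polynomial map associated to the group $G(m,t,2)$, and let $N\ge1$. Let $\Psi=\{\psi(\beta,\cdot,\cdot):\beta\in\mathbb{T}\}$ where $\psi(\beta,p_1,p_2)=\frac{2\beta p_2^t-p_1}{2-\beta p_1}$ for $(p_1,p_2)\in\theta(\mathbb{D}^2)$. Any holomorphic function $f:\theta(\mathbb{D}^2)\to\mathbb{M}_N(\mathbb{C})$ in the $\Psi$-Schur-Agler class $\mathcal{SA}_\Psi(\mathbb{C}^N)$ can be approximated, uniformly on compact subsets of $\theta(\mathbb{D}^2)$, by ($N\times N$) matrix-valued rational inner functions on $\theta(\mathbb{D}^2)$.
   Context: $\mathbb{D}$ is the open unit disc, $\mathbb{T}$ the unit circle. The map $\theta=(\theta_1,\theta_2)$ is $\theta_1(z_1,z_2)=z_1^m+z_2^m$, $\theta_2(z_1,z_2)=(z_1z_2)^{m/t}$. ($G(m,t,2)$ is the group of maps $(z_1,z_2)\mapsto(\alpha^{\nu_1}z_{\sigma(1)},\alpha^{\nu_2}z_{\sigma(2)})$ with $\alpha=e^{2\pi i/m}$, $\sigma\in S_2$ and integers $\nu_1,\nu_2$ whose sum is divisible by $t$.) Write $\partial\theta(\mathbb{D}^2)=\theta(\mathbb{T}^2)$, and let $\mu$ be the push-forward under $\theta$ of the normalized Haar measure on $\mathbb{T}^2$. A rational map $\Phi:\theta(\mathbb{D}^2)\to\mathbb{M}_N(\mathbb{C})$ is called inner if $\Phi(\boldsymbol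 p)^*\Phi(\boldsymbol p)=I_N$ for $\mu$-a.e. $\boldsymbol p\in\partial\theta(\mathbb{D}^2)$. For a Hilbert space $\mathcal{H}$ and $X=\theta(\mathbb{D}^2)$, let $\mathcal{K}_\Psi(\mathcal{H})$ be the collection of $\mathcal{B}(\mathcal{H})$-valued positive kernels $k$ on $X$ such that, for each $\psi\in\Psi$, the function $(x,y)\mapsto(1-\psi(x)\overline{\psi(y)})k(x,y)$ is a $\mathcal{B}(\mathcal{H})$-valued positive kernel. A function $f:X\to\mathcal{B}(\mathcal{H})$ is in $H^\infty_\Psi(\mathcal{H})$ if there is a constant $C\ge0$ such that $(x,y)\mapsto C^2k(x,y)-f(x)k(x,y)f(y)^*$ is a $\mathcal{B}(\mathcal{H})$-valued positive kernel for each $k\in\mathcal{K}_\Psi(\mathcal{H})$; $C_f$ denotes the smallest such $C$. The $\Psi$-Schur-Agler class $\mathcal{SA}_\Psi(\mathcal{H})$ is the set of $f\in H^\infty_\Psi(\mathcal{H})$ with $C_f\le1$. *)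

theory Defs
  imports
    "HOL-Analysis.Analysis"
    "HOL-Probability.Probability"
    "HOL-Computational_Algebra.Polynomial"
begin

text \<open>
  Matrices in \<open>M\<^sub>N(\<complex>) = B(\<complex>\<^sup>N)\<close> are of type \<^typ>\<open>complex^'n^'n\<close> with \<open>N = CARD('n)\<close>; functions
  and kernels on a set \<open>X\<close> are total functions about which only the values on \<open>X\<close> matter.
\<close>

definition cscale :: "complex \<Rightarrow> complex^'n^'m \<Rightarrow> complex^'n^'m" where
  "cscale c A = (\<chi> i j. c * A $ i $ j)"

definition mat_adj :: "complex^'n^'m \<Rightarrow> complex^'m^'n" where
  "mat_adj A = (\<chi> i j. cnj (A $ j $ i))"

text \<open>Linear in the first argument.\<close>
definition cinner_vec :: "complex^'n \<Rightarrow> complex^'n \<Rightarrow> complex" where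
  "cinner_vec u v = (\<Sum>i\<in>UNIV. u $ i * cnj (v $ i))"

definition basic_map :: "nat \<Rightarrow> nat \<Rightarrow> complex \<times> complex \<Rightarrow> complex \<times> complex" where
  "basic_map m t = (\<lambda>(z1, z2). (z1 ^ m + z2 ^ m, (z1 * z2) ^ (m div t)))"

definition theta_bidisc :: "nat \<Rightarrow> nat \<Rightarrow> (complex \<times> complex) set" where
  "theta_bidisc m t = basic_map m t ` (ball 0 1 \<times> ball 0 1)"

definition theta_boundary :: "nat \<Rightarrow> nat \<Rightarrow> (complex \<times> complex) set" where
  "theta_boundary m t = basic_map m t ` (sphere 0 1 \<times> sphere 0 1)"

definition circle_haar :: "complex measure" where
  "circle_haar = distr (uniform_measure lborel {0..2 * pi}) borel cis"

definition theta_measure :: "nat \<Rightarrow> nat \<Rightarrow> (complex \<times> complex) measure" where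
  "theta_measure m t = distr (circle_haar \<Otimes>\<^sub>M circle_haar) borel (basic_map m t)"

definition psi :: "nat \<Rightarrow> complex \<Rightarrow> complex \<times> complex \<Rightarrow> complex" where
  "psi t \<beta> = (\<lambda>(p1, p2). (2 * \<beta> * p2 ^ t - p1) / (2 - \<beta> * p1))"

definition Psi :: "nat \<Rightarrow> (complex \<times> complex \<Rightarrow> complex) set" where
  "Psi t = {psi t \<beta> | \<beta>. \<beta> \<in> sphere 0 1}"

definition pos_kernel_on :: "'x set \<Rightarrow> ('x \<Rightarrow> 'x \<Rightarrow> complex^'n^'n) \<Rightarrow> bool" where
  "pos_kernel_on X k \<longleftrightarrow>
     (\<forall>(r::nat) (x :: nat \<Rightarrow> 'x) (v :: nat \<Rightarrow> complex^'n). (\<forall>i<r. x i \<in> X) \<longrightarrow>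
        (\<Sum>i<r. \<Sum>j<r. cinner_vec (k (x i) (x j) *v v j) (v i)) \<in> \<real>\<^sub>\<ge>\<^sub>0)"

definition admissible_kernels ::
  "'x set \<Rightarrow> ('x \<Rightarrow> complex) set \<Rightarrow> ('x \<Rightarrow> 'x \<Rightarrow> complex^'n^'n) set" where
  "admissible_kernels X \<Psi> =
     {k. pos_kernel_on X k \<and>
         (\<forall>\<psi>\<in>\<Psi>. pos_kernel_on X (\<lambda>x y. cscale (1 - \<psi> x * cnj (\<psi> y)) (k x y)))}"

definition H_inf_bound ::
  "'x set \<Rightarrow> ('x \<Rightarrow> complex) set \<Rightarrow> ('x \<Rightarrow> complex^'n^'n) \<Rightarrow> real \<Rightarrow> bool" where
  "H_inf_bound X \<Psi> f C \<longleftrightarrow> 0 \<le> C \<and>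
     (\<forall>k\<in>admissible_kernels X \<Psi>.
        pos_kernel_on X (\<lambda>x y. C\<^sup>2 *\<^sub>R k x y - f x ** k x y ** mat_adj (f y)))"

definition H_inf :: "'x set \<Rightarrow> ('x \<Rightarrow> complex) set \<Rightarrow> ('x \<Rightarrow> complex^'n^'n) set" where
  "H_inf X \<Psi> = {f. \<exists>C. H_inf_bound X \<Psi> f C}"

text \<open>
  On \<^const>\<open>H_inf\<close> the least constant exists, since the admissible constants form a closed set.
\<close>
definition H_inf_const ::
  "'x set \<Rightarrow> ('x \<Rightarrow> complex) set \<Rightarrow> ('x \<Rightarrow> complex^'n^'n) \<Rightarrow> real" where
  "H_inf_const X \<Psi> f = (LEAST C. H_inf_bound X \<Psi> f C)"

definition schur_agler ::
  "'x set \<Rightarrow> ('x \<Rightarrow> complex) set \<Rightarrow> ('x \<Rightarrow> complex^'n^'n) set" where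
  "schur_agler X \<Psi> = {f \<in> H_inf X \<Psi>. H_inf_const X \<Psi> f \<le> 1}"

text \<open>
  Complex Frechet differentiability in two variables: \<open>A\<close> and \<open>B\<close> are the partial derivatives,
  and every complex-linear map from \<open>\<complex>\<^sup>2\<close> to matrices has the displayed form.
\<close>
definition holomorphic2_on ::
  "(complex \<times> complex \<Rightarrow> complex^'n^'n) \<Rightarrow> (complex \<times> complex) set \<Rightarrow> bool" where
  "holomorphic2_on f X \<longleftrightarrow>
     (\<forall>p\<in>X. \<exists>A B. (f has_derivative (\<lambda>h. cscale (fst h) A + cscale (snd h) B)) (at p within X))"

text \<open>
  Polynomials in two variables are polynomials in \<open>p\<^sub>2\<close> whose coefficients are polynomials in \<open>p\<^sub>1\<close>.
\<close>
definition eval2 :: "complex poly poly \<Rightarrow> complex \<times> complex \<Rightarrow> complex" where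
  "eval2 P = (\<lambda>(p1, p2). poly (poly P [:p2:]) p1)"

text \<open>
  The denominators have no zeros on \<open>X\<close>. The function extends beyond \<open>X\<close>, in particular to
  boundary points, by the same quotients; its values at zeros of a denominator are
  unconstrained. On \<open>\<theta>(T\<^sup>2)\<close> these zeros form a null set.
\<close>
definition rational_map_on ::
  "(complex \<times> complex) set \<Rightarrow> (complex \<times> complex \<Rightarrow> complex^'n^'n) \<Rightarrow> bool" where
  "rational_map_on X \<Phi> \<longleftrightarrow>
     (\<forall>i j. \<exists>P Q. (\<forall>p\<in>X. eval2 Q p \<noteq> 0) \<and>
        (\<forall>p. eval2 Q p \<noteq> 0 \<longrightarrow> \<Phi> p $ i $ j = eval2 P p / eval2 Q p))"

definition rational_inner ::
  "nat \<Rightarrow> nat \<Rightarrow> (complex \<times> complex \<Rightarrow> complex^'n^'n) \<Rightarrow> bool" where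
  "rational_inner m t \<Phi> \<longleftrightarrow> rational_map_on (theta_bidisc m t) \<Phi> \<and>
     (AE p in theta_measure m t. p \<in> theta_boundary m t \<longrightarrow> mat_adj (\<Phi> p) ** \<Phi> p = mat 1)"

end

theory Submission imports Defs "HOL-Complex_Analysis.Complex_Analysis" begin

text \<open>
  The one-point kernels are admissible, so a function in the Schur-Agler class is pointwise a
  contraction, and no realization formula is needed. For \<open>0 < r < 1\<close> the Cayley transform
  \<open>F = (1 - r f) / (1 + r f)\<close> has positive real part, and \<open>F \<circ> \<theta>\<close> is bounded, holomorphic and
  \<open>G(m,t,2)\<close>-invariant on the bidisc; hence a dilation of \<open>F\<close> is approximated, uniformly on the
  closure of the domain, by a polynomial matrix \<open>H\<close> in \<open>(p\<^sub>1, p\<^sub>2)\<close> with positive real part.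

  On the distinguished boundary \<open>cnj p\<^sub>1 = p\<^sub>1 / p\<^sub>2\<^sup>t\<close> and \<open>cnj p\<^sub>2 = 1 / p\<^sub>2\<close>, so there \<open>w H\<^sup>*\<close> is a
  polynomial whenever \<open>w\<close> is a high power of \<open>p\<^sub>2\<close>. The matrix \<open>K = (H + w H\<^sup>*) / (1 - w)\<close> is
  skew-adjoint on the boundary, has nonnegative real part inside by the minimum principle, and
  tends to \<open>H\<close> locally uniformly as the power grows. Therefore \<open>(1 - K) / (1 + K)\<close> is rational
  inner and close to \<open>(1 - H) / (1 + H)\<close>, hence to \<open>r f\<close>.
\<close>

text \<open>Unitarity is a quadratic condition that polynomial approximation destroys. The Cayley
  transform turns it into skew-adjointness, a real-linear condition, which the combination
  \<open>H + w H^*\<close> over \<open>1 - w\<close> meets exactly.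

  The price is that the approximant must keep nonnegative real part, and a merely nonnegative one
  could be spoiled by any error. Hence the factor \<open>r\<close>: the transform of
  \<open>r f\<close> exists, is bounded, and has real part at least \<open>(1 - r^2) / 4\<close>, so
  a small enough error leaves a strictly positive \<open>H\<close>. Strict positivity is used again
  at boundary points with \<open>w = 1\<close>, where \<open>K\<close> has a pole: it keeps the
  quotient, cleared of its denominator, well defined there.

  The repair is compatible with approximation because adjoints on the distinguished boundary cost
  only powers of \<open>p\<^sub>2\<close>, whose modulus is less than one inside. The factor
  \<open>w\<close> is unimodular where unitarity is required and negligible on compact sets.\<close>

unbundle no fps_syntax

section \<open>Accretive matrices and the Cayley transform\<close>

lemma inner_cmult_left: "inner (c * x) y = inner x (cnj c * y)" for c x y :: complex
  by (simp add: inner_complex_def algebra_simps)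

lemma inner_scalar_mult_left: "inner (c *s x) y = inner x (cnj c *s y)" for x y :: "complex^'n"
  by (simp add: inner_vec_def inner_cmult_left)

text \<open>\<open>inner\<close> is the real part of the Hermitian product. It is nondegenerate over
  the reals, so it still determines the adjoint, and unitarity and positivity can be tested with
  real-valued products.\<close>

lemma inner_mat_adj_right:
  fixes A :: "complex^'n^'m"
  shows "inner (A *v x) y = inner x (mat_adj A *v y)"
proof -
  have "inner (A *v x) y = (\<Sum>i\<in>UNIV. \<Sum>j\<in>UNIV. inner (A $ i $ j * x $ j) (y $ i))"
    by (simp add: inner_vec_def matrix_vector_mult_def inner_sum_left)
  also have "\<dots> = (\<Sum>j\<in>UNIV. \<Sum>i\<in>UNIV. inner (x $ j) (cnj (A $ i $ j) * y $ i))"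
    unfolding inner_cmult_left by (rule sum.swap)
  also have "\<dots> = inner x (mat_adj A *v y)"
    by (simp add: inner_vec_def matrix_vector_mult_def inner_sum_right mat_adj_def)
  finally show ?thesis .
qed

lemma mat_adj_mat_adj [simp]: "mat_adj (mat_adj A) = A"
  by (simp add: mat_adj_def vec_eq_iff)

lemma inner_mat_adj_left:
  fixes A :: "complex^'n^'m"
  shows "inner (mat_adj A *v x) y = inner x (A *v y)"
  by (simp add: inner_mat_adj_right)

lemma cscale_vector_mult: "cscale c A *v x = c *s (A *v x)"
  by (simp add: cscale_def matrix_vector_mult_def vec_eq_iff sum_distrib_left mult.assoc)

lemma scaleR_vector_mult: "(r *\<^sub>R A) *v x = r *\<^sub>R (A *v x)" for A :: "complex^'n^'m"
  by (simp add: matrix_vector_mult_def vec_eq_iff scaleR_sum_right)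

lemma mult_vector_scalar: "A *v (c *s x) = c *s (A *v x)" for A :: "complex^'n^'m"
  by (simp add: matrix_vector_mult_def vec_eq_iff sum_distrib_left mult_ac)

lemma isometry_imp_mat_adj_inverse:
  fixes A :: "complex^'n^'m"
  assumes "\<And>x y. inner (A *v x) (A *v y) = inner x y"
  shows "mat_adj A ** A = mat 1"
proof -
  have "inner x ((mat_adj A ** A) *v y) = inner x (mat 1 *v y)" for x y
    using assms[of x y] by (simp add: inner_mat_adj_right matrix_vector_mul_assoc)
  then show ?thesis
    by (metis matrix_eq vector_eq_ldot)
qed

lemma matrix_inv_cancel:
  fixes A :: "complex^'n^'n"
  assumes "invertible A"
  shows "A *v (matrix_inv A *v x) = x" "matrix_inv A *v (A *v x) = x"
proof -
  have *: "A ** matrix_inv A = mat 1 \<and> matrix_inv A ** A = mat 1"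
    unfolding matrix_inv_def by (rule someI_ex) (use assms in \<open>simp add: invertible_def\<close>)
  then show "A *v (matrix_inv A *v x) = x" "matrix_inv A *v (A *v x) = x"
    by (simp_all add: matrix_vector_mul_assoc)
qed

lemma invertible_if_bounded_below:
  fixes A :: "complex^'n^'n"
  assumes "c > 0" and "\<And>x. c * norm x \<le> norm (A *v x)"
  shows "invertible A"
proof -
  have "x = 0" if "A *v x = 0" for x
    using assms(2)[of x] that \<open>c > 0\<close>
    by (simp add: mult_le_0_iff)
  then show ?thesis
    by (simp add: invertible_left_inverse matrix_left_invertible_ker)
qed

lemma norm_axis_one: "norm (axis j (1::complex)) = 1"
  by (simp add: norm_eq_sqrt_inner inner_axis_axis)

lemma matrix_component_le:
  fixes A :: "complex^'n^'m"
  assumes "\<And>x. norm (A *v x) \<le> e * norm x"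
  shows "cmod (A $ i $ j) \<le> e"
proof -
  have "A *v axis j 1 = (\<chi> i. A $ i $ j)"
    by (simp add: matrix_vector_mult_def axis_def if_distrib vec_eq_iff cong: if_cong)
  then have "cmod (A $ i $ j) \<le> norm (A *v axis j 1)"
    by (metis Finite_Cartesian_Product.norm_nth_le vec_lambda_beta)
  also have "\<dots> \<le> e"
    using assms[of "axis j 1"] by (simp add: norm_axis_one)
  finally show ?thesis .
qed

lemma norm_vec_le_sum: "norm x \<le> (\<Sum>i\<in>UNIV. norm (x $ i))"
  unfolding norm_vec_def by (rule L2_set_le_sum) simp

text \<open>Polynomials approximate entry by entry, while the Cayley estimates use the operator
  norm. Together with \<open>matrix_component_le\<close> this passes between the two, at the cost of
  the number of entries.\<close>

lemma matrix_vector_norm_le: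
  fixes A :: "complex^'n^'m"
  assumes "\<And>i j. cmod (A $ i $ j) \<le> e"
  shows "norm (A *v x) \<le> real CARD('m) * real CARD('n) * e * norm x"
proof -
  have "norm ((A *v x) $ i) \<le> real CARD('n) * (e * norm x)" for i
  proof -
    have "norm ((A *v x) $ i) \<le> (\<Sum>j\<in>UNIV. norm (A $ i $ j * x $ j))"
      unfolding matrix_vector_mult_def by (simp add: sum_norm_le)
    also have "\<dots> \<le> (\<Sum>j\<in>(UNIV::'n set). e * norm x)"
      unfolding norm_mult using assms order_trans[OF norm_ge_zero assms]
      by (intro sum_mono mult_mono) (auto simp: Finite_Cartesian_Product.norm_nth_le)
    finally show ?thesis by simp
  qed
  then have "(\<Sum>i\<in>UNIV. norm ((A *v x) $ i)) \<le> (\<Sum>i\<in>(UNIV::'m set). real CARD('n) * (e * norm x))"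
    by (intro sum_mono)
  with norm_vec_le_sum[of "A *v x"] show ?thesis by (simp add: mult.assoc)
qed

lemma norm_matrix_le:
  fixes A :: "complex^'n^'m"
  assumes "\<And>i j. cmod (A $ i $ j) \<le> e"
  shows "norm A \<le> real CARD('m) * real CARD('n) * e"
proof -
  have "norm (A $ i) \<le> real CARD('n) * e" for i
    using norm_vec_le_sum[of "A $ i"] sum_mono[of UNIV "\<lambda>j. norm (A $ i $ j)" "\<lambda>_. e"] assms
    by (simp add: order_trans)
  then have "(\<Sum>i\<in>UNIV. norm (A $ i)) \<le> (\<Sum>i\<in>(UNIV::'m set). real CARD('n) * e)"
    by (intro sum_mono)
  with norm_vec_le_sum[of A] show ?thesis by (simp add: mult.assoc)
qed

text \<open>As \<open>inner\<close> is the real part of the Hermitian product, this says that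
  \<open>A + A^*\<close> is positive semidefinite.\<close>

definition accretive :: "complex^'n^'n \<Rightarrow> bool" where
  "accretive A \<longleftrightarrow> (\<forall>x. 0 \<le> inner x (A *v x))"

text \<open>An involution wherever \<open>mat 1 + A\<close> is invertible. It carries accretive
  matrices to contractions and skew-adjoint ones to unitaries.\<close>

definition cayley :: "complex^'n^'n \<Rightarrow> complex^'n^'n" where
  "cayley A = (mat 1 - A) ** matrix_inv (mat 1 + A)"

text \<open>Pairing \<open>(mat 1 + A) *v x\<close> with \<open>x\<close> gives the bound. It does
  not depend on the size of \<open>A\<close>, which makes the Cayley transform Lipschitz with a
  universal constant.\<close>

lemma accretive_norm_le:
  assumes "accretive A"
  shows "norm x \<le> norm ((mat 1 + A) *v x)"
proof -
  have "norm x * norm x = inner x x" by (simp add: dot_square_norm power2_eq_square)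
  also have "\<dots> \<le> inner x ((mat 1 + A) *v x)"
    using assms by (simp add: accretive_def matrix_vector_mult_add_rdistrib inner_add_right)
  also have "\<dots> \<le> norm x * norm ((mat 1 + A) *v x)" by (rule norm_cauchy_schwarz)
  finally show ?thesis by (cases "x = 0") simp_all
qed

lemma accretive_invertible: "accretive A \<Longrightarrow> invertible (mat 1 + A)"
  using invertible_if_bounded_below[of 1 "mat 1 + A"] accretive_norm_le by auto

lemma cayley_vector_mult:
  assumes "invertible (mat 1 + A)"
  shows "cayley A *v ((mat 1 + A) *v y) = (mat 1 - A) *v y"
  by (simp add: cayley_def matrix_inv_cancel(2)[OF assms] flip: matrix_vector_mul_assoc)

text \<open>The transform is \<open>2 (1 + A)^-1 - 1\<close>. In the resolvent identity
  \<open>(1 + A)^-1 - (1 + B)^-1 = (1 + A)^-1 (B - A) (1 + B)^-1\<close> both inverses have norm at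
  most one.\<close>

lemma cayley_lipschitz:
  assumes A: "accretive A" and B: "accretive B"
    and e: "\<And>x. norm ((A - B) *v x) \<le> e * norm x"
  shows "norm ((cayley A - cayley B) *v x) \<le> 2 * e * norm x"
proof -
  define u v where "u = matrix_inv (mat 1 + A) *v x" and "v = matrix_inv (mat 1 + B) *v x"
  have u: "(mat 1 + A) *v u = x" and v: "(mat 1 + B) *v v = x"
    using A B by (simp_all add: u_def v_def matrix_inv_cancel accretive_invertible)
  have cA: "cayley A *v x = 2 *\<^sub>R u - x"
    using cayley_vector_mult[OF accretive_invertible[OF A], of u] u
    by (metis (no_types, lifting) add_diff_cancel_right diff_diff_eq2 matrix_vector_mul_lid
        matrix_vector_mult_add_rdistrib matrix_vector_mult_diff_rdistrib scaleR_2 add.commute)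
  have cB: "cayley B *v x = 2 *\<^sub>R v - x"
    using cayley_vector_mult[OF accretive_invertible[OF B], of v] v
    by (metis (no_types, lifting) add_diff_cancel_right diff_diff_eq2 matrix_vector_mul_lid
        matrix_vector_mult_add_rdistrib matrix_vector_mult_diff_rdistrib scaleR_2 add.commute)
  have uv: "(mat 1 + A) *v (u - v) = (B - A) *v v"
    using u v by (simp add: algebra_simps)
  \<comment> \<open>The sign of \<open>e\<close> follows from testing on any one unit vector;
    \<open>undefined\<close> is just some index.\<close>
  have e0: "0 \<le> e"
    using order_trans[OF norm_ge_zero e[of "axis undefined 1"]] by (simp add: norm_axis_one)
  have "norm (u - v) \<le> norm ((B - A) *v v)"
    using accretive_norm_le[OF A, of "u - v"] uv by simp
  also have "\<dots> = norm ((A - B) *v v)"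
    by (simp add: matrix_vector_mult_diff_rdistrib norm_minus_commute)
  also have "\<dots> \<le> e * norm v" by (rule e)
  also have "\<dots> \<le> e * norm x"
    using accretive_norm_le[OF B, of v] v e0 by (simp add: mult_left_mono)
  finally have "norm (2 *\<^sub>R (u - v)) \<le> 2 * e * norm x" by simp
  moreover have "(cayley A - cayley B) *v x = 2 *\<^sub>R (u - v)"
    by (simp add: matrix_vector_mult_diff_rdistrib cA cB algebra_simps)
  ultimately show ?thesis by simp
qed

lemma contraction_invertible:
  fixes A :: "complex^'n^'n"
  assumes c: "\<And>x. norm (A *v x) \<le> norm x" and r: "0 < r" "r < 1"
  shows "(1 - r) * norm x \<le> norm ((mat 1 + r *\<^sub>R A) *v x)" "invertible (mat 1 + r *\<^sub>R A)"
proof -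
  show *: "(1 - r) * norm x \<le> norm ((mat 1 + r *\<^sub>R A) *v x)" for x
  proof -
    have "norm x \<le> norm ((mat 1 + r *\<^sub>R A) *v x) + norm (r *\<^sub>R (A *v x))"
      by (metis add_diff_cancel_right' matrix_vector_mul_lid matrix_vector_mult_add_rdistrib
          norm_triangle_ineq4 scaleR_vector_mult)
    also have "norm (r *\<^sub>R (A *v x)) \<le> r * norm x" using c r by simp
    finally show ?thesis by (simp add: algebra_simps)
  qed
  show "invertible (mat 1 + r *\<^sub>R A)"
    using invertible_if_bounded_below[of "1 - r"] * r by auto
qed

text \<open>Writing \<open>x = y + r A y\<close>, the transform sends \<open>x\<close> to
  \<open>y - r A y\<close>. Their product is \<open>|y|^2 - |r A y|^2\<close>, at least
  \<open>(1 - r^2) |y|^2\<close>, and \<open>|x| \<le> 2 |y|\<close> accounts for the 4. The upper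
  bound uses \<open>(1 - r) |y| \<le> |x|\<close>.\<close>

lemma cayley_contraction:
  fixes A :: "complex^'n^'n"
  assumes c: "\<And>x. norm (A *v x) \<le> norm x" and r: "0 < r" "r < 1"
  shows "(1 - r\<^sup>2) / 4 * (norm x)\<^sup>2 \<le> inner x (cayley (r *\<^sub>R A) *v x)"
    and "norm (cayley (r *\<^sub>R A) *v x) \<le> 2 / (1 - r) * norm x"
    and "cayley (cayley (r *\<^sub>R A)) = r *\<^sub>R A"
proof -
  let ?F = "cayley (r *\<^sub>R A)"
  note inv = contraction_invertible[OF c r]
  have F: "?F *v (y + r *\<^sub>R (A *v y)) = y - r *\<^sub>R (A *v y)" for y
    using cayley_vector_mult[OF inv(2), of y]
    by (simp add: matrix_vector_mult_add_rdistrib matrix_vector_mult_diff_rdistrib scaleR_vector_mult)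
  have ex: "\<exists>y. x = y + r *\<^sub>R (A *v y)" for x
    using matrix_inv_cancel(1)[OF inv(2), of x]
    by (metis matrix_vector_mul_lid matrix_vector_mult_add_rdistrib scaleR_vector_mult)
  have rA: "norm (r *\<^sub>R (A *v y)) \<le> r * norm y" for y using c r by simp
  have acc: "(1 - r\<^sup>2) / 4 * (norm x)\<^sup>2 \<le> inner x (?F *v x)" for x
  proof -
    obtain y where y: "x = y + r *\<^sub>R (A *v y)" using ex by blast
    have "norm (r *\<^sub>R (A *v y)) \<le> norm y"
      using order_trans[OF rA[of y]] r mult_right_mono[of r 1 "norm y"] by simp
    then have "norm x \<le> 2 * norm y"
      using norm_triangle_ineq[of y "r *\<^sub>R (A *v y)"] y by simp
    then have "(norm x)\<^sup>2 \<le> 4 * (norm y)\<^sup>2"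
      using power_mono[of "norm x" "2 * norm y" 2] by (simp add: power_mult_distrib)
    then have "(1 - r\<^sup>2) / 4 * (norm x)\<^sup>2 \<le> (1 - r\<^sup>2) / 4 * (4 * (norm y)\<^sup>2)"
      using r by (intro mult_left_mono) (auto simp: abs_square_le_1)
    also have "\<dots> = (norm y)\<^sup>2 - (r * norm y)\<^sup>2"
      by (simp add: field_simps power_mult_distrib)
    also have "\<dots> \<le> (norm y)\<^sup>2 - (norm (r *\<^sub>R (A *v y)))\<^sup>2"
      using power_mono[OF rA norm_ge_zero, of y 2] by simp
    also have "\<dots> = inner x (?F *v x)"
      unfolding y F by (simp add: inner_add_left inner_diff_right dot_square_norm inner_commute
          algebra_simps power2_eq_square)
    finally show ?thesis .
  qed
  show "(1 - r\<^sup>2) / 4 * (norm x)\<^sup>2 \<le> inner x (?F *v x)" by (rule acc)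
  show "norm (?F *v x) \<le> 2 / (1 - r) * norm x"
  proof -
    obtain y where y: "x = y + r *\<^sub>R (A *v y)" using ex by blast
    have "norm (?F *v x) \<le> norm y + r * norm y"
      unfolding y F using rA[of y] norm_triangle_ineq4[of y "r *\<^sub>R (A *v y)"] by linarith
    also have "\<dots> \<le> 2 * norm y" using r mult_right_mono[of r 1 "norm y"] by simp
    also have "(1 - r) * norm y \<le> norm x"
      using inv(1)[of y] y by (simp add: matrix_vector_mult_add_rdistrib scaleR_vector_mult)
    then have "2 * norm y \<le> 2 / (1 - r) * norm x"
      using r by (simp add: field_simps)
    finally show ?thesis by simp
  qed
  have "accretive ?F"
    unfolding accretive_def
  proof
    fix x :: "complex^'n"
    have "0 \<le> (1 - r\<^sup>2) / 4 * (norm x)\<^sup>2"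
      using r by (intro mult_nonneg_nonneg) (auto simp: abs_square_le_1)
    with acc[of x] show "0 \<le> inner x (?F *v x)" by linarith
  qed
  note invF = accretive_invertible[OF this]
  have "cayley ?F *v y = (r *\<^sub>R A) *v y" for y
  proof -
    \<comment> \<open>Chosen to solve \<open>(mat 1 + ?F) *v x = y\<close>: the vectors
      \<open>y + r A y\<close> and \<open>y - r A y\<close> have half-sum \<open>y\<close> and
      half-difference \<open>r A y\<close>.\<close>
    define x where "x = (1/2) *\<^sub>R (y + r *\<^sub>R (A *v y))"
    have "?F *v x = (1/2) *\<^sub>R (y - r *\<^sub>R (A *v y))"
      unfolding x_def using F[of y]
      by (metis (no_types, lifting) matrix_vector_mul_linear linear_scale)
    moreover have "(1/2) *\<^sub>R (a + b) + (1/2) *\<^sub>R (a - b) = a"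
      "(1/2) *\<^sub>R (a + b) - (1/2) *\<^sub>R (a - b) = b" for a b :: "complex^'n"
      by (simp_all add: scaleR_2[symmetric] flip: scaleR_add_right scaleR_diff_right)
    ultimately have "(mat 1 + ?F) *v x = y" "(mat 1 - ?F) *v x = r *\<^sub>R (A *v y)"
      by (simp_all add: matrix_vector_mult_add_rdistrib matrix_vector_mult_diff_rdistrib x_def)
    with cayley_vector_mult[OF invF, of x] show ?thesis by (simp add: scaleR_vector_mult)
  qed
  then show "cayley ?F = r *\<^sub>R A" by (simp add: matrix_eq)
qed

text \<open>
  For \<open>w\<close> of modulus one, \<open>K = (H + w H\<^sup>*) / (1 - w)\<close> is skew-adjoint, so its Cayley transform,
  written here without the division, is unitary.
\<close>
lemma unitary_quotient:
  fixes H :: "complex^'n^'n"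
  assumes w: "w * cnj w = 1"
    and L: "L = H + cscale w (mat_adj H)"
    and inv: "invertible (cscale (1 - w) (mat 1) + L)"
  defines "\<Phi> \<equiv> (cscale (1 - w) (mat 1) - L) ** matrix_inv (cscale (1 - w) (mat 1) + L)"
  shows "mat_adj \<Phi> ** \<Phi> = mat 1"
proof (rule isometry_imp_mat_adj_inverse)
  let ?D = "cscale (1 - w) (mat 1) + L" and ?E = "cscale (1 - w) (mat 1) - L"
  fix x y
  define u v where "u = matrix_inv ?D *v x" and "v = matrix_inv ?D *v y"
  have u: "x = ?D *v u" "\<Phi> *v x = ?E *v u" and v: "y = ?D *v v" "\<Phi> *v y = ?E *v v"
    using inv by (simp_all add: u_def v_def \<Phi>_def matrix_inv_cancel matrix_vector_mul_assoc[symmetric])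
  have w': "inner (w *s a) (w *s b) = inner a b" for a b :: "complex^'n"
    using w by (simp add: inner_scalar_mult_left vector_smult_assoc mult.commute)
  have sd: "(1 - w) *s a = a - w *s a" for a :: "complex^'n"
    by (simp add: vec_eq_iff algebra_simps)
  have DE: "?D *v a = (a - w *s a) + L *v a" "?E *v a = (a - w *s a) - L *v a" for a
    by (simp_all add: matrix_vector_mult_add_rdistrib matrix_vector_mult_diff_rdistrib cscale_vector_mult sd)
  have LL: "L *v a = H *v a + w *s (mat_adj H *v a)" for a
    by (simp add: L matrix_vector_mult_add_rdistrib cscale_vector_mult)
  have 1: "inner (H *v a) b = inner a (mat_adj H *v b)" for a b by (rule inner_mat_adj_right)
  have 2: "inner (mat_adj H *v a) b = inner a (H *v b)" for a b by (rule inner_mat_adj_left)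
  have 3: "inner (w *s (mat_adj H *v a)) b = inner (w *s a) (H *v b)" for a b
    by (simp add: 2[symmetric] mult_vector_scalar)
  \<comment> \<open>This is skew-adjointness of \<open>L / (1 - w)\<close> with the denominators
    cleared. The products for \<open>?D\<close> and \<open>?E\<close> differ only in the sign of
    these cross terms.\<close>
  have "inner (u - w *s u) (L *v v) + inner (L *v u) (v - w *s v) = 0"
    unfolding LL by (simp add: inner_diff_left inner_diff_right inner_add_left inner_add_right w' 3 1 2 mult_vector_scalar)
  then show "inner (\<Phi> *v x) (\<Phi> *v y) = inner x y"
    unfolding u(2) v(2) unfolding u(1) v(1) DE by (simp add: inner_diff_left inner_diff_right inner_add_left inner_add_right)
qed

section \<open>Polynomial approximation on the bidisc\<close>

definition unity_root :: "nat \<Rightarrow> nat \<Rightarrow> complex" where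
  "unity_root n k = cis (2 * pi * real k / real n)"

lemma unity_root_norm [simp]: "cmod (unity_root n k) = 1"
  by (simp add: unity_root_def)

lemma unity_root_power: "unity_root n k ^ j = unity_root n (k * j)"
proof -
  have "real j * (2 * pi * real k / real n) = 2 * pi * real (k * j) / real n" by simp
  then show ?thesis unfolding unity_root_def by (metis Complex.DeMoivre)
qed

lemma unity_root_mult: "unity_root n j * unity_root n k = unity_root n (j + k)"
  by (simp add: unity_root_def cis_mult add_divide_distrib ring_distribs)

lemma unity_root_eq_1_iff:
  assumes "n > 0"
  shows "unity_root n k = 1 \<longleftrightarrow> n dvd k"
proof
  assume "unity_root n k = 1"
  then have "Re (unity_root n k) = 1" by simp
  then have "cos (2 * pi * real k / real n) = 1" by (simp add: unity_root_def)
  then obtain i :: int where "2 * pi * real k / real n = of_int i * 2 * pi"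
    unfolding cos_one_2pi_int by blast
  then have "real k = of_int i * real n" using assms by (simp add: field_simps)
  then have "of_int (int k) = (of_int (i * int n) :: real)" by simp
  then have "int k = i * int n" unfolding of_int_eq_iff .
  then show "n dvd k" by (metis dvd_triv_right int_dvd_int_iff)
next
  assume "n dvd k"
  then obtain i where "k = n * i" by blast
  then have "2 * pi * real k / real n = 2 * pi * real i" using assms by simp
  then show "unity_root n k = 1"
    unfolding unity_root_def
    by (metis Ints_of_nat cis_multiple_2pi)
qed

lemma sum_unity_root:
  assumes "n > 0"
  shows "(\<Sum>j<n. unity_root n (k * j)) = (if n dvd k then of_nat n else 0)"
proof -
  have *: "(\<Sum>j<n. unity_root n (k * j)) = (\<Sum>j<n. unity_root n k ^ j)"
    by (simp add: unity_root_power)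
  show ?thesis
  proof (cases "n dvd k")
    case True
    then show ?thesis using assms * by (simp add: unity_root_eq_1_iff[symmetric])
  next
    case False
    have "unity_root n k ^ n = 1"
      using assms by (simp add: unity_root_power unity_root_eq_1_iff)
    moreover have "unity_root n k \<noteq> 1" using False assms by (simp add: unity_root_eq_1_iff)
    ultimately show ?thesis using False * by (simp add: geometric_sum)
  qed
qed

section \<open>Taylor coefficients and interpolation at roots of unity\<close>

lemma holomorphic_coefficients:
  assumes u: "u holomorphic_on ball 0 1" and B: "\<And>z. z \<in> ball 0 1 \<Longrightarrow> cmod (u z) \<le> B"
  obtains c where "\<And>n. cmod (c n) \<le> B" "\<And>z. z \<in> ball 0 1 \<Longrightarrow> (\<lambda>n. c n * z ^ n) sums u z"
proof
  let ?c = "\<lambda>n. (deriv ^^ n) u 0 / fact n"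
  show "(\<lambda>n. ?c n * z ^ n) sums u z" if "z \<in> ball 0 1" for z
    using holomorphic_power_series[OF u that] by simp
  show "cmod (?c n) \<le> B" for n
  proof -
    \<comment> \<open>Cauchy's estimate is available only for radii \<open>r < 1\<close>, as
      \<open>u\<close> need not extend to the circle; letting \<open>r\<close> tend to 1 removes the
      factor \<open>r ^ n\<close>.\<close>
    have *: "cmod (?c n) * r ^ n \<le> B" if r: "0 < r" "r < 1" for r
    proof -
      have sub: "cball 0 r \<subseteq> ball (0::complex) 1" "ball 0 r \<subseteq> ball (0::complex) 1" using r by auto
      have "cmod ((deriv ^^ n) u 0) \<le> fact n * B / r ^ n"
        by (rule Cauchy_inequality)
          (use r B sub u in \<open>auto intro: holomorphic_on_subset
            intro!: holomorphic_on_imp_continuous_on\<close>)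
      then show ?thesis using r by (simp add: norm_divide field_simps)
    qed
    have "((\<lambda>r. cmod (?c n) * r ^ n) \<longlongrightarrow> cmod (?c n) * 1 ^ n) (at_left (1::real))"
      by (intro tendsto_intros)
    moreover have "eventually (\<lambda>r. cmod (?c n) * r ^ n \<le> B) (at_left (1::real))"
      using eventually_at_left_real[of 0 1] by (rule eventually_mono) (use * in auto)
    ultimately show ?thesis
      using tendsto_upperbound[of _ _ "at_left (1::real)" B] by simp
  qed
qed

lemma sum_swap_pairs:
  "(\<Sum>i\<in>I. \<Sum>j\<in>J. \<Sum>a\<in>A. \<Sum>b\<in>B. f i j a b) = (\<Sum>a\<in>A. \<Sum>b\<in>B. \<Sum>i\<in>I. \<Sum>j\<in>J. f i j a b)"
proof -
  have "(\<Sum>i\<in>I. \<Sum>j\<in>J. \<Sum>a\<in>A. \<Sum>b\<in>B. f i j a b) = (\<Sum>i\<in>I. \<Sum>a\<in>A. \<Sum>b\<in>B. \<Sum>j\<in>J. f i j a b)"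
    by (rule sum.cong[OF refl], subst sum.swap, rule sum.cong[OF refl], rule sum.swap)
  also have "\<dots> = (\<Sum>a\<in>A. \<Sum>b\<in>B. \<Sum>i\<in>I. \<Sum>j\<in>J. f i j a b)"
    by (subst sum.swap, rule sum.cong[OF refl], rule sum.swap)
  finally show ?thesis .
qed

definition interp_node :: "nat \<Rightarrow> real \<Rightarrow> nat \<Rightarrow> complex" where
  "interp_node L s j = of_real s * unity_root L j"

text \<open>The Lagrange basis polynomial of the node \<open>interp_node L s j\<close> in discrete
  Fourier form: the average over \<open>a < L\<close> of the powers \<open>(z / node)^a\<close>.
  With natural exponents, \<open>unity_root L ((L - a) * j)\<close> serves as the inverse of
  \<open>unity_root L (a * j)\<close>.\<close>

definition interp_basis :: "nat \<Rightarrow> real \<Rightarrow> nat \<Rightarrow> complex \<Rightarrow> complex" where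
  "interp_basis L s j z =
     (\<Sum>a<L. z ^ a * unity_root L ((L - a) * j) / (of_nat L * of_real s ^ a))"

text \<open>Aliasing: every node has \<open>L\<close>-th power \<open>s ^ L\<close>, so on the nodes
  a monomial of high degree coincides with a multiple of one of degree below
  \<open>L\<close>.\<close>

lemma interp_node_power_mod:
  assumes "L > 0"
  shows "interp_node L s j ^ n = of_real s ^ (n - n mod L) * interp_node L s j ^ (n mod L)"
proof -
  have "unity_root L j ^ n = unity_root L j ^ (L * (n div L)) * unity_root L j ^ (n mod L)"
    by (simp flip: power_add)
  also have "unity_root L j ^ (L * (n div L)) = 1"
    using assms unity_root_eq_1_iff[OF assms, of "j * (L * (n div L))"] by (simp add: unity_root_power)
  finally show ?thesis
    by (simp add: interp_node_def power_mult_distrib mult_ac) (simp flip: power_add mult.assoc)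
qed

lemma interp_basis_reproduces:
  assumes "a < L" "s > 0"
  shows "(\<Sum>j<L. interp_node L s j ^ a * interp_basis L s j z) = z ^ a"
proof -
  have L: "L > 0" using assms by simp
  have "(\<Sum>j<L. interp_node L s j ^ a * interp_basis L s j z) =
     (\<Sum>j<L. \<Sum>b<L. (of_real s ^ a * z ^ b / (of_nat L * of_real s ^ b)) * unity_root L ((a + (L - b)) * j))"
    unfolding interp_basis_def interp_node_def sum_distrib_left
  proof (intro sum.cong refl)
    fix j b
    have "unity_root L ((a + (L - b)) * j) = unity_root L j ^ a * unity_root L ((L - b) * j)"
      unfolding unity_root_power unity_root_mult by (simp add: ring_distribs mult.commute)
    then show "(of_real s * unity_root L j) ^ a * (z ^ b * unity_root L ((L - b) * j) / (of_nat L * of_real s ^ b))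
      = of_real s ^ a * z ^ b / (of_nat L * of_real s ^ b) * unity_root L ((a + (L - b)) * j)"
      by (simp add: power_mult_distrib)
  qed
  also have "\<dots> = (\<Sum>b<L. (of_real s ^ a * z ^ b / (of_nat L * of_real s ^ b)) *
      (\<Sum>j<L. unity_root L ((a + (L - b)) * j)))"
    unfolding sum_distrib_left by (rule sum.swap)
  also have "\<dots> = (\<Sum>b<L. if b = a then z ^ a else 0)"
  proof (rule sum.cong[OF refl])
    fix b assume b: "b \<in> {..<L}"
    \<comment> \<open>The number \<open>a + (L - b)\<close> lies strictly between 0 and
      \<open>2 * L\<close>, so \<open>L\<close> is the only multiple it can be.\<close>
    have "L dvd a + (L - b) \<longleftrightarrow> b = a"
    proof
      assume d: "L dvd a + (L - b)"
      then obtain k where k: "a + (L - b) = L * k" by blast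
      have "k = 1"
      proof (rule ccontr)
        assume "k \<noteq> 1"
        then consider "k = 0" | "k \<ge> 2" by linarith
        then show False
        proof cases
          case 1 then show False using k b by simp
        next
          case 2
          then have "L * 2 \<le> L * k" by (intro mult_le_mono2)
          moreover have "a + (L - b) < L * 2" using b assms by simp
          ultimately show False using k by linarith
        qed
      qed
      then show "b = a" using k b by simp
    qed (use b in auto)
    then show "of_real s ^ a * z ^ b / (of_nat L * of_real s ^ b) * (\<Sum>j<L. unity_root L ((a + (L - b)) * j))
        = (if b = a then z ^ a else 0)"
      using L assms by (simp add: sum_unity_root)
  qed
  also have "\<dots> = z ^ a" using assms by simp
  finally show ?thesis .
qed

text \<open>Degrees below \<open>L\<close> are reproduced exactly. By aliasing, \<open>z ^ n\<close>
  with \<open>n \<ge> L\<close> is interpolated by a monomial of modulus at most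
  \<open>s ^ n\<close>, so its term costs at most \<open>2 * B * s ^ n\<close>; the geometric tail
  gives the bound.\<close>

lemma interpolation_error:
  assumes u: "u holomorphic_on ball 0 1" and B: "\<And>z. z \<in> ball 0 1 \<Longrightarrow> cmod (u z) \<le> B"
    and s: "0 < s" "s < 1" and L: "L > 0" and z: "cmod z \<le> s"
  shows "cmod (u z - (\<Sum>j<L. u (interp_node L s j) * interp_basis L s j z)) \<le> 2 * s ^ L / (1 - s) * B"
proof -
  obtain c where c: "\<And>n. cmod (c n) \<le> B"
    and sums: "\<And>z. z \<in> ball 0 1 \<Longrightarrow> (\<lambda>n. c n * z ^ n) sums u z"
    using holomorphic_coefficients[OF u B] by blast
  have B0: "0 \<le> B" using order_trans[OF norm_ge_zero c] .
  define e where "e n = z ^ n - (\<Sum>j<L. interp_node L s j ^ n * interp_basis L s j z)" for n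
  have e: "e n = z ^ n - of_real s ^ (n - n mod L) * z ^ (n mod L)" for n
    unfolding e_def interp_node_power_mod[OF L, of s _ n] mult.assoc sum_distrib_left[symmetric]
    using interp_basis_reproduces[of "n mod L" L s z] L s by simp
  have e0: "e n = 0" if "n < L" for n
    using that by (simp add: e)
  have e1: "cmod (e n) \<le> 2 * s ^ n" for n
  proof -
    have "cmod (of_real s ^ (n - n mod L) * z ^ (n mod L)) \<le> s ^ (n - n mod L) * s ^ (n mod L)"
      using s z by (simp add: norm_mult norm_power mult_left_mono power_mono)
    also have "\<dots> = s ^ n" by (simp flip: power_add)
    finally have "cmod (of_real s ^ (n - n mod L) * z ^ (n mod L)) \<le> s ^ n" .
    moreover have "cmod (z ^ n) \<le> s ^ n" using z by (simp add: norm_power power_mono)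
    ultimately show ?thesis unfolding e
      using norm_triangle_ineq4[of "z ^ n" "of_real s ^ (n - n mod L) * z ^ (n mod L)"] by linarith
  qed
  have node: "interp_node L s j \<in> ball 0 1" for j
    using s by (simp add: interp_node_def norm_mult)
  have "(\<lambda>n. c n * z ^ n - (\<Sum>j<L. c n * interp_node L s j ^ n * interp_basis L s j z)) sums
      (u z - (\<Sum>j<L. u (interp_node L s j) * interp_basis L s j z))"
    using z s by (intro sums_diff sums sums_sum sums_mult2 node) auto
  also have "(\<lambda>n. c n * z ^ n - (\<Sum>j<L. c n * interp_node L s j ^ n * interp_basis L s j z)) =
      (\<lambda>n. c n * e n)"
    by (simp add: e_def algebra_simps sum_distrib_left)
  finally have S: "(\<lambda>n. c n * e n) sums (u z - (\<Sum>j<L. u (interp_node L s j) * interp_basis L s j z))" .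
  have "(\<lambda>n. c (n + L) * e (n + L)) sums
      (u z - (\<Sum>j<L. u (interp_node L s j) * interp_basis L s j z) - (\<Sum>n<L. c n * e n))"
    by (rule sums_split_initial_segment[OF S])
  then have T: "(\<lambda>n. c (n + L) * e (n + L)) sums
      (u z - (\<Sum>j<L. u (interp_node L s j) * interp_basis L s j z))"
    by (simp add: e0)
  have "(\<lambda>n. s ^ n) sums (1 / (1 - s))" using s by (intro geometric_sums) simp
  then have G: "(\<lambda>n. 2 * B * s ^ L * s ^ n) sums (2 * B * s ^ L * (1 / (1 - s)))" by (rule sums_mult)
  have "cmod (c (n + L) * e (n + L)) \<le> 2 * B * s ^ L * s ^ n" for n
    using mult_mono[OF c e1 B0 norm_ge_zero, of "n + L" "n + L"]
    by (simp add: norm_mult power_add mult_ac)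
  then have "cmod (\<Sum>n. c (n + L) * e (n + L)) \<le> (\<Sum>n. 2 * B * s ^ L * s ^ n)"
    by (intro norm_suminf_le) (use G in \<open>auto simp: sums_iff\<close>)
  then show ?thesis using sums_unique[OF T] sums_unique[OF G] by (simp add: mult_ac)
qed

text \<open>Interpolating in one variable at a time keeps the other variable holomorphic, so no
  two-variable power series are needed.\<close>
lemma polydisc_polynomial_approximation:
  fixes g :: "complex \<Rightarrow> complex \<Rightarrow> complex"
  assumes hol1: "\<And>y. y \<in> ball 0 1 \<Longrightarrow> (\<lambda>x. g x y) holomorphic_on ball 0 1"
    and hol2: "\<And>x. x \<in> ball 0 1 \<Longrightarrow> (\<lambda>y. g x y) holomorphic_on ball 0 1"
    and B: "\<And>x y. x \<in> ball 0 1 \<Longrightarrow> y \<in> ball 0 1 \<Longrightarrow> cmod (g x y) \<le> B"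
    and s: "0 < s" "s < 1" and \<epsilon>: "\<epsilon> > 0"
  shows "\<exists>(L :: nat) c. \<forall>x y. cmod x \<le> s \<longrightarrow> cmod y \<le> s \<longrightarrow>
       cmod (g x y - (\<Sum>a<L. \<Sum>b<L. c a b * x ^ a * y ^ b)) < \<epsilon>"
proof -
  have B0: "0 \<le> B" using order_trans[OF norm_ge_zero B[of 0 0]] by simp
  \<comment> \<open>The first variable costs \<open>\<delta> * B\<close> and the second
    \<open>\<delta> * (2 * B)\<close>; \<open>4 * (B + 1)\<close> exceeds \<open>3 * B\<close>
    strictly, also when \<open>B = 0\<close>. The cap at 1 bounds the first interpolant by
    \<open>2 * B\<close>, as the second interpolation requires.\<close>
  define \<delta> where "\<delta> = min 1 (\<epsilon> / (4 * (B + 1)))"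
  have "\<delta> \<le> \<epsilon> / (4 * (B + 1))" unfolding \<delta>_def by (rule min.cobounded2)
  then have \<delta>3: "\<delta> * (4 * (B + 1)) \<le> \<epsilon>" using B0 by (subst (asm) pos_le_divide_eq) auto
  have \<delta>: "0 < \<delta>" "\<delta> \<le> 1" using \<epsilon> B0 by (auto simp: \<delta>_def)
  have "(\<lambda>L. 2 * s ^ L / (1 - s)) \<longlonglongrightarrow> 2 * 0 / (1 - s)"
    using s by (intro tendsto_intros LIMSEQ_power_zero) auto
  then have "eventually (\<lambda>L. 2 * s ^ L / (1 - s) < \<delta>) sequentially"
    using \<delta>(1) by (simp add: order_tendsto_iff)
  then obtain L where L: "L > 0" "2 * s ^ L / (1 - s) < \<delta>"
    using eventually_conj[OF _ eventually_gt_at_top[of 0]] eventually_sequentially by (metis (no_types, lifting) order_refl)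
  define I where "I x y = (\<Sum>i<L. g (interp_node L s i) y * interp_basis L s i x)" for x y
  define P where "P x y = (\<Sum>j<L. I x (interp_node L s j) * interp_basis L s j y)" for x y
  define c where "c a b = (\<Sum>i<L. \<Sum>j<L. g (interp_node L s i) (interp_node L s j) *
      (unity_root L ((L - a) * i) / (of_nat L * of_real s ^ a)) *
      (unity_root L ((L - b) * j) / (of_nat L * of_real s ^ b)))" for a b
  have node: "interp_node L s j \<in> ball 0 1" for j
    using s by (simp add: interp_node_def norm_mult)
  have *: "cmod (g x y - P x y) < \<epsilon>" if x: "cmod x \<le> s" and y: "cmod y \<le> s" for x y
  proof -
    have I: "cmod (g x v - I x v) \<le> \<delta> * B" if v: "v \<in> ball 0 1" for v
    proof -
      have "cmod (g x v - I x v) \<le> 2 * s ^ L / (1 - s) * B"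
        unfolding I_def by (rule interpolation_error[OF hol1[OF v] B[OF _ v] s L(1) x])
      also have "\<dots> \<le> \<delta> * B" using L B0 by (intro mult_right_mono) auto
      finally show ?thesis .
    qed
    have IB: "cmod (I x v) \<le> 2 * B" if v: "v \<in> ball 0 1" for v
    proof -
      have "cmod (I x v) \<le> cmod (g x v) + cmod (g x v - I x v)"
        by (metis norm_minus_commute norm_triangle_sub)
      also have "\<dots> \<le> B + 1 * B"
        using B[OF _ v, of x] I[OF v] x s \<delta> B0 mult_right_mono[OF \<delta>(2) B0] by (intro add_mono) auto
      finally show ?thesis by simp
    qed
    have "(\<lambda>v. I x v) holomorphic_on ball 0 1"
      unfolding I_def by (intro holomorphic_intros hol2 node)
    then have "cmod (I x y - P x y) \<le> 2 * s ^ L / (1 - s) * (2 * B)"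
      unfolding P_def by (intro interpolation_error IB s L y)
    also have "\<dots> \<le> \<delta> * (2 * B)" using L B0 by (intro mult_right_mono) auto
    finally have "cmod (g x y - P x y) \<le> \<delta> * B + \<delta> * (2 * B)"
      using I[of y] y s norm_triangle_ineq[of "g x y - I x y" "I x y - P x y"] by (simp add: algebra_simps)
    also have "\<dots> < \<delta> * (4 * (B + 1))"
    proof -
      have "\<delta> * (4 * (B + 1)) = \<delta> * B + \<delta> * (2 * B) + \<delta> * B + 4 * \<delta>" by (simp add: algebra_simps)
      with mult_nonneg_nonneg[of \<delta> B] \<delta>(1) B0 show ?thesis by linarith
    qed
    also have "\<dots> \<le> \<epsilon>" by (rule \<delta>3)
    finally show ?thesis .
  qed
  have "P x y = (\<Sum>a<L. \<Sum>b<L. c a b * x ^ a * y ^ b)" for x y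
  proof -
    have "P x y = (\<Sum>i<L. \<Sum>j<L. g (interp_node L s i) (interp_node L s j) *
        (interp_basis L s i x * interp_basis L s j y))"
      unfolding P_def I_def sum_distrib_right by (subst sum.swap) (simp add: mult.assoc)
    also have "\<dots> = (\<Sum>i<L. \<Sum>j<L. \<Sum>a<L. \<Sum>b<L. g (interp_node L s i) (interp_node L s j) *
      (unity_root L ((L - a) * i) / (of_nat L * of_real s ^ a)) *
      (unity_root L ((L - b) * j) / (of_nat L * of_real s ^ b)) * x ^ a * y ^ b)"
      unfolding interp_basis_def sum_product unfolding sum_distrib_left
      by (intro sum.cong refl) (simp add: mult_ac)
    also have "\<dots> = (\<Sum>a<L. \<Sum>b<L. \<Sum>i<L. \<Sum>j<L. g (interp_node L s i) (interp_node L s j) *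
      (unity_root L ((L - a) * i) / (of_nat L * of_real s ^ a)) *
      (unity_root L ((L - b) * j) / (of_nat L * of_real s ^ b)) * x ^ a * y ^ b)"
      by (rule sum_swap_pairs)
    finally show ?thesis by (simp add: c_def sum_distrib_right)
  qed
  with * show ?thesis by (intro exI[of _ L] exI[of _ c]) simp
qed

section \<open>Polynomials in the basic invariants\<close>

text \<open>Closure rules let polynomiality of determinants be read off termwise and reflections be
  found by induction; \<open>poly2_eval2\<close> returns to coefficients.\<close>

inductive poly2 :: "(complex \<times> complex \<Rightarrow> complex) \<Rightarrow> bool" where
  poly2_const: "poly2 (\<lambda>p. c)"
| poly2_fst: "poly2 (\<lambda>p. fst p)"
| poly2_snd: "poly2 (\<lambda>p. snd p)"
| poly2_add: "poly2 F \<Longrightarrow> poly2 G \<Longrightarrow> poly2 (\<lambda>p. F p + G p)"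
| poly2_mult: "poly2 F \<Longrightarrow> poly2 G \<Longrightarrow> poly2 (\<lambda>p. F p * G p)"

lemma poly2_diff: "poly2 F \<Longrightarrow> poly2 G \<Longrightarrow> poly2 (\<lambda>p. F p - G p)"
  using poly2_add[OF _ poly2_mult[OF poly2_const[of "-1"]], of F G] by simp

lemma poly2_power: "poly2 F \<Longrightarrow> poly2 (\<lambda>p. F p ^ k)"
  by (induction k) (auto intro: poly2_const poly2_mult)

lemma poly2_sum: "(\<And>i. i \<in> I \<Longrightarrow> poly2 (F i)) \<Longrightarrow> poly2 (\<lambda>p. \<Sum>i\<in>I. F i p)"
  by (induction I rule: infinite_finite_induct) (auto intro: poly2_const poly2_add)

lemma poly2_prod: "(\<And>i. i \<in> I \<Longrightarrow> poly2 (F i)) \<Longrightarrow> poly2 (\<lambda>p. \<Prod>i\<in>I. F i p)"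
  by (induction I rule: infinite_finite_induct) (auto intro: poly2_const poly2_mult)

lemma poly2_det:
  fixes A :: "complex \<times> complex \<Rightarrow> complex^'n^'n"
  assumes "\<And>i j. poly2 (\<lambda>p. A p $ i $ j)"
  shows "poly2 (\<lambda>p. det (A p))"
  unfolding det_def by (intro poly2_sum poly2_mult poly2_const poly2_prod assms)

lemmas poly2_intros = poly2_const poly2_fst poly2_snd poly2_add poly2_mult poly2_diff poly2_power
  poly2_sum poly2_prod poly2_det

lemma poly2_eval2: "poly2 F \<Longrightarrow> \<exists>P. \<forall>p. F p = eval2 P p"
proof (induction rule: poly2.induct)
  case (poly2_const c)
  show ?case by (intro exI[of _ "[:[:c:]:]"]) (simp add: eval2_def split: prod.split)
next
  case poly2_fst
  show ?case by (intro exI[of _ "[:[:0, 1:]:]"]) (simp add: eval2_def split: prod.split)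
next
  case poly2_snd
  show ?case by (intro exI[of _ "[:0, 1:]"]) (simp add: eval2_def split: prod.split)
next
  case (poly2_add F G)
  then obtain P Q where "\<forall>p. F p = eval2 P p" "\<forall>p. G p = eval2 Q p" by blast
  then show ?case by (intro exI[of _ "P + Q"]) (simp add: eval2_def split: prod.split)
next
  case (poly2_mult F G)
  then obtain P Q where "\<forall>p. F p = eval2 P p" "\<forall>p. G p = eval2 Q p" by blast
  then show ?case by (intro exI[of _ "P * Q"]) (simp add: eval2_def split: prod.split)
qed

lemma poly2_compose_scale: "poly2 F \<Longrightarrow> poly2 (\<lambda>p. F (a * fst p, b * snd p))"
  by (induction rule: poly2.induct) (auto intro: poly2_intros)

lemma poly2_holomorphic:
  assumes "poly2 F" "u holomorphic_on S" "v holomorphic_on S"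
  shows "(\<lambda>x. F (u x, v x)) holomorphic_on S"
  using assms(1) by (induction rule: poly2.induct) (auto intro!: holomorphic_intros assms(2,3))

lemma poly2_continuous: "poly2 F \<Longrightarrow> continuous_on S F"
  by (induction rule: poly2.induct) (auto intro!: continuous_intros)

text \<open>The hypotheses on \<open>p\<close> hold on the distinguished boundary, where they express
  \<open>cnj p\<^sub>1 = p\<^sub>1 / p\<^sub>2\<^sup>t\<close> and \<open>cnj p\<^sub>2 = 1 / p\<^sub>2\<close>.\<close>
lemma poly2_reflection:
  assumes "poly2 F"
  shows "\<exists>M G. poly2 G \<and> (\<forall>p. cmod (snd p) = 1 \<longrightarrow> cnj (fst p) * snd p ^ t = fst p \<longrightarrow>
    G p = snd p ^ M * cnj (F p))"
  using assms
proof (induction rule: poly2.induct)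
  case (poly2_const c)
  show ?case by (intro exI[of _ 0] exI[of _ "\<lambda>p. cnj c"]) (auto intro: poly2.poly2_const)
next
  case poly2_fst
  show ?case by (intro exI[of _ t] exI[of _ "\<lambda>p. fst p"]) (auto intro: poly2.poly2_fst simp: mult.commute)
next
  case poly2_snd
  have "p * cnj p = 1" if "cmod p = 1" for p
    using complex_norm_square[of p] that by simp
  then show ?case by (intro exI[of _ 1] exI[of _ "\<lambda>p. 1"]) (auto intro: poly2.poly2_const)
next
  case (poly2_add F1 F2)
  then obtain M1 M2 G1 G2 where "poly2 G1" "poly2 G2"
    "\<forall>p. cmod (snd p) = 1 \<longrightarrow> cnj (fst p) * snd p ^ t = fst p \<longrightarrow> G1 p = snd p ^ M1 * cnj (F1 p)"
    "\<forall>p. cmod (snd p) = 1 \<longrightarrow> cnj (fst p) * snd p ^ t = fst p \<longrightarrow> G2 p = snd p ^ M2 * cnj (F2 p)"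
    by blast
  \<comment> \<open>The two reflections carry different powers of \<open>snd p\<close>; each is
    multiplied by the power of the other.\<close>
  then show ?case
    by (intro exI[of _ "M1 + M2"] exI[of _ "\<lambda>p. snd p ^ M2 * G1 p + snd p ^ M1 * G2 p"] conjI)
      (auto intro!: poly2_intros simp: power_add algebra_simps)
next
  case (poly2_mult F1 F2)
  then obtain M1 M2 G1 G2 where "poly2 G1" "poly2 G2"
    "\<forall>p. cmod (snd p) = 1 \<longrightarrow> cnj (fst p) * snd p ^ t = fst p \<longrightarrow> G1 p = snd p ^ M1 * cnj (F1 p)"
    "\<forall>p. cmod (snd p) = 1 \<longrightarrow> cnj (fst p) * snd p ^ t = fst p \<longrightarrow> G2 p = snd p ^ M2 * cnj (F2 p)"
    by blast
  then show ?case
    by (intro exI[of _ "M1 + M2"] exI[of _ "\<lambda>p. G1 p * G2 p"] conjI)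
      (auto intro!: poly2_intros simp: power_add algebra_simps)
qed

lemma poly2_matrix_reflection:
  fixes H :: "complex \<times> complex \<Rightarrow> complex^'n^'n"
  assumes "\<And>i j. poly2 (\<lambda>p. H p $ i $ j)"
  obtains M and J :: "complex \<times> complex \<Rightarrow> complex^'n^'n" where "\<And>i j. poly2 (\<lambda>p. J p $ i $ j)"
    "\<And>p. cmod (snd p) = 1 \<Longrightarrow> cnj (fst p) * snd p ^ t = fst p \<Longrightarrow>
       J p = cscale (snd p ^ M) (mat_adj (H p))"
proof -
  have "\<forall>i j. \<exists>M G. poly2 G \<and> (\<forall>p. cmod (snd p) = 1 \<longrightarrow> cnj (fst p) * snd p ^ t = fst p \<longrightarrow>
    G p = snd p ^ M * cnj (H p $ j $ i))"
    using poly2_reflection[OF assms] by blast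
  then obtain M G where G: "\<And>i j. poly2 (G i j)" "\<And>i j p. cmod (snd p) = 1 \<Longrightarrow>
      cnj (fst p) * snd p ^ t = fst p \<Longrightarrow> G i j p = snd p ^ M i j * cnj (H p $ j $ i)"
    by metis
  \<comment> \<open>The sum dominates every \<open>M i j\<close>, so one exponent serves all
    entries; the witness supplies the missing powers of \<open>snd p\<close>.\<close>
  define M' where "M' = (\<Sum>i\<in>UNIV. \<Sum>j\<in>UNIV. M i j)"
  have le: "M i j \<le> M'" for i j
  proof -
    have "M i j \<le> (\<Sum>j\<in>UNIV. M i j)" by (rule member_le_sum) auto
    also have "\<dots> \<le> M'" unfolding M'_def by (rule member_le_sum[of i]) auto
    finally show ?thesis .
  qed
  show thesis
  proof (rule that[of "\<lambda>p. \<chi> i j. snd p ^ (M' - M i j) * G i j p" M'])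
    show "poly2 (\<lambda>p. (\<chi> i j. snd p ^ (M' - M i j) * G i j p) $ i $ j)" for i j
      by (auto intro!: poly2_intros G)
    show "(\<chi> i j. snd p ^ (M' - M i j) * G i j p) = cscale (snd p ^ M') (mat_adj (H p))"
      if "cmod (snd p) = 1" "cnj (fst p) * snd p ^ t = fst p" for p
      using le by (simp add: cscale_def mat_adj_def vec_eq_iff G(2)[OF that] mult.assoc[symmetric]
          flip: power_add)
  qed
qed

section \<open>Entries of inverse matrices by Cramer's rule\<close>

lemma matrix_inv_component:
  fixes B :: "complex^'n^'n"
  assumes "det B \<noteq> 0"
  shows "matrix_inv B $ k $ j =
    det (\<chi> i l. if l = k then (if i = j then 1 else 0) else B $ i $ l) / det B"
proof -
  have "invertible B" using assms by (simp add: invertible_det_nz)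
  then have "B *v (matrix_inv B *v axis j 1) = axis j 1" by (rule matrix_inv_cancel)
  then have "matrix_inv B *v axis j 1 = (\<chi> k. det (\<chi> i l. if l = k then axis j 1 $ i else B $ i $ l) / det B)"
    using cramer[OF assms] by blast
  then have "(matrix_inv B *v axis j 1) $ k = det (\<chi> i l. if l = k then axis j 1 $ i else B $ i $ l) / det B"
    by simp
  moreover have "(matrix_inv B *v axis j 1) $ k = matrix_inv B $ k $ j"
    by (simp add: matrix_vector_mult_def axis_def if_distrib cong: if_cong)
  ultimately show ?thesis by (simp only: axis_def vec_lambda_beta)
qed

text \<open>Cramer's rule puts all entries over the single denominator \<open>det (B p)\<close>,
  which is nonzero exactly where \<open>B p\<close> is invertible.\<close>

lemma rational_map_on_quotient:
  fixes A B :: "complex \<times> complex \<Rightarrow> complex^'n^'n"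
  assumes A: "\<And>i j. poly2 (\<lambda>p. A p $ i $ j)" and B: "\<And>i j. poly2 (\<lambda>p. B p $ i $ j)"
    and X: "\<And>p. p \<in> X \<Longrightarrow> invertible (B p)"
  shows "rational_map_on X (\<lambda>p. A p ** matrix_inv (B p))"
  unfolding rational_map_on_def
proof (intro allI)
  fix i j
  define F where "F p = (\<Sum>k\<in>UNIV. A p $ i $ k *
      det (\<chi> i l. if l = k then (if i = j then 1 else 0) else B p $ i $ l))" for p
  have "poly2 (\<lambda>p. if c then 1 else B p $ i $ l)" "poly2 (\<lambda>p. if c then 0 else B p $ i $ l)" for c i l
    by (cases c; simp add: B poly2_const)+
  then have "poly2 F"
    unfolding F_def by (intro poly2_intros A) (auto intro: poly2_const)
  moreover have "poly2 (\<lambda>p. det (B p))" by (intro poly2_intros B)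
  ultimately obtain P Q where PQ: "\<And>p. F p = eval2 P p" "\<And>p. det (B p) = eval2 Q p"
    using poly2_eval2 by metis
  have "(A p ** matrix_inv (B p)) $ i $ j = F p / det (B p)" if "det (B p) \<noteq> 0" for p
    using that by (simp add: F_def matrix_matrix_mult_def matrix_inv_component sum_divide_distrib)
  then show "\<exists>P Q. (\<forall>p\<in>X. eval2 Q p \<noteq> 0) \<and>
      (\<forall>p. eval2 Q p \<noteq> 0 \<longrightarrow> (A p ** matrix_inv (B p)) $ i $ j = eval2 P p / eval2 Q p)"
    using X by (intro exI[of _ P] exI[of _ Q]) (auto simp: PQ[symmetric] invertible_det_nz)
qed

section \<open>Invariant polynomials of \<open>G(m,t,2)\<close>\<close>

lemma basic_map_Pair: "basic_map m t (x, y) = (x ^ m + y ^ m, (x * y) ^ (m div t))"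
  by (simp add: basic_map_def)

lemma snd_basic_map_power:
  "t dvd m \<Longrightarrow> snd (basic_map m t (x, y)) ^ t = x ^ m * y ^ m"
  by (simp add: basic_map_Pair power_mult_distrib flip: power_mult)

text \<open>Newton's recurrence for the power sums of \<open>x ^ m\<close> and \<open>y ^ m\<close>:
  their sum is the first invariant, their product the \<open>t\<close>-th power of the
  second.\<close>

lemma power_sum_poly2:
  assumes "t dvd m"
  shows "\<exists>N. poly2 N \<and> (\<forall>x y. N (basic_map m t (x, y)) = x ^ (m * k) + y ^ (m * k))"
proof (induction k rule: nat_less_induct)
  case (1 k)
  consider "k = 0" | "k = 1" | "2 \<le> k" by linarith
  then show ?case
  proof cases
    case 1
    then show ?thesis by (intro exI[of _ "\<lambda>p. 2"]) (auto intro: poly2_const)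
  next
    case 2
    then show ?thesis by (intro exI[of _ "\<lambda>p. fst p"]) (auto intro: poly2_fst simp: basic_map_Pair)
  next
    case 3
    then obtain k' where k': "k = k' + 2" using le_Suc_ex[of 2 k] by (auto simp: add.commute)
    obtain N1 N2 where N: "poly2 N1" "poly2 N2"
      "\<And>x y. N1 (basic_map m t (x, y)) = x ^ (m * k') + y ^ (m * k')"
      "\<And>x y. N2 (basic_map m t (x, y)) = x ^ (m * (k' + 1)) + y ^ (m * (k' + 1))"
      using 1[rule_format, of k'] 1[rule_format, of "k' + 1"] k' by auto
    show ?thesis
    proof (intro exI[of _ "\<lambda>p. fst p * N2 p - snd p ^ t * N1 p"] conjI allI)
      show "poly2 (\<lambda>p. fst p * N2 p - snd p ^ t * N1 p)" by (intro poly2_intros N)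
      show "fst (basic_map m t (x, y)) * N2 (basic_map m t (x, y)) -
          snd (basic_map m t (x, y)) ^ t * N1 (basic_map m t (x, y)) = x ^ (m * k) + y ^ (m * k)" for x y
        unfolding snd_basic_map_power[OF assms] N k'
        by (simp add: basic_map_Pair power_add power_mult algebra_simps)
    qed
  qed
qed

text \<open>The factor \<open>(x * y) ^ b\<close> splits off and leaves a power sum. The condition
  on \<open>b\<close> says that \<open>m div t\<close> divides \<open>b\<close>, which makes the
  factor a power of the second invariant.\<close>

lemma symmetric_monomial_poly2_aux:
  assumes t: "t dvd m" "t > 0" "m > 0" and b: "m dvd t * b"
  shows "\<exists>N. poly2 N \<and> (\<forall>x y. N (basic_map m t (x, y)) = x ^ (b + m * k) * y ^ b + y ^ (b + m * k) * x ^ b)"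
proof -
  obtain l where l: "m = t * l" using t by blast
  then obtain c where c: "b = l * c" using b t by auto
  obtain N where N: "poly2 N" "\<And>x y. N (basic_map m t (x, y)) = x ^ (m * k) + y ^ (m * k)"
    using power_sum_poly2[OF t(1), of k] by blast
  show ?thesis
  proof (intro exI[of _ "\<lambda>p. snd p ^ c * N p"] conjI allI)
    show "poly2 (\<lambda>p. snd p ^ c * N p)" by (intro poly2_intros N)
    have "snd (basic_map m t (x, y)) ^ c = x ^ b * y ^ b" for x y
      using t by (simp add: basic_map_Pair l c power_mult_distrib power_mult)
    then show "snd (basic_map m t (x, y)) ^ c * N (basic_map m t (x, y)) =
        x ^ (b + m * k) * y ^ b + y ^ (b + m * k) * x ^ b" for x y
      by (simp add: N power_add algebra_simps)
  qed
qed

text \<open>The divisibility conditions express invariance of \<open>x ^ a * y ^ b\<close> under the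
  diagonal part of the group. As \<open>m - 1\<close> stands for -1, the second says that
  \<open>a\<close> and \<open>b\<close> agree modulo \<open>m\<close>, and the smaller exponent can
  be split off.\<close>

lemma symmetric_monomial_poly2:
  assumes t: "t dvd m" "t > 0" "m > 0" and a: "m dvd t * a" and ab: "m dvd a + (m - 1) * b"
  shows "\<exists>N. poly2 N \<and> (\<forall>x y. N (basic_map m t (x, y)) = x ^ a * y ^ b + y ^ a * x ^ b)"
proof -
  obtain q where "a + (m - 1) * b = m * q" using ab by blast
  moreover have "a + (m - 1) * b + b = a + m * b" using t by (cases m) auto
  ultimately have "(a + m * b) mod m = (m * q + b) mod m" by simp
  then have mod: "a mod m = b mod m" by simp
  then have b: "m dvd t * b"
    using a mod by (metis mod_eq_0_iff_dvd mod_mult_eq)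
  show ?thesis
  proof (cases "b \<le> a")
    case True
    then obtain k where "a = b + m * k"
      using mod mod_eq_nat1E by blast
    then show ?thesis using symmetric_monomial_poly2_aux[OF t b, of k] by simp
  next
    case False
    then obtain k where "b = a + m * k"
      using mod mod_eq_nat1E[of b m a] by (metis nat_le_linear)
    then show ?thesis using symmetric_monomial_poly2_aux[OF t a, of k] by (simp add: mult.commute add.commute)
  qed
qed

text \<open>The diagonal group elements have exponents \<open>j + t * k\<close> and
  \<open>-j\<close>, with sum divisible by \<open>t\<close>; \<open>(m - 1) * j\<close> represents
  \<open>-j\<close> modulo \<open>m\<close>.\<close>

lemma basic_map_invariant:
  assumes t: "t dvd m" "m > 0"
  shows "basic_map m t (unity_root m (j + t * k) * x, unity_root m ((m - 1) * j) * y) = basic_map m t (x, y)"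
proof -
  obtain l where l: "m = t * l" using t by blast
  have 1: "unity_root m i ^ m = 1" for i
    using t by (simp add: unity_root_power unity_root_eq_1_iff)
  have "j + t * k + (m - 1) * j = m * j + t * k" using t by (cases m) auto
  moreover have "m div t = l" using t l by simp
  ultimately have "(unity_root m (j + t * k) * unity_root m ((m - 1) * j)) ^ (m div t) =
      unity_root m ((m * j + t * k) * l)"
    by (simp only: unity_root_mult unity_root_power)
  also have "(m * j + t * k) * l = m * (j * l + k)" by (simp add: l algebra_simps)
  also have "unity_root m \<dots> = 1" using t by (simp add: unity_root_eq_1_iff)
  finally have 2: "(unity_root m (j + t * k) * unity_root m ((m - 1) * j)) ^ (m div t) = 1" .
  have "(unity_root m (j + t * k) * x) * (unity_root m ((m - 1) * j) * y) =
      (unity_root m (j + t * k) * unity_root m ((m - 1) * j)) * (x * y)"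
    by simp
  then have "((unity_root m (j + t * k) * x) * (unity_root m ((m - 1) * j) * y)) ^ (m div t) =
      (x * y) ^ (m div t)"
    by (simp only: power_mult_distrib[of _ "x * y"] 2 mult_1_left)
  then show ?thesis
    by (simp only: basic_map_Pair power_mult_distrib[of _ x m] power_mult_distrib[of _ y m] 1 mult_1_left)
qed

lemma basic_map_swap: "basic_map m t (y, x) = basic_map m t (x, y)"
  by (simp add: basic_map_Pair mult.commute add.commute)

text \<open>Orthogonality is used once in \<open>j\<close> and once in \<open>k\<close>. When
  \<open>t\<close> divides \<open>m\<close>, the \<open>m\<close> values of \<open>k\<close> count
  each diagonal group element \<open>t\<close> times, which leaves an average unchanged.\<close>

lemma unity_root_double_average:
  assumes "m > 0"
  shows "(\<Sum>j<m. \<Sum>k<m. unity_root m (j + t * k) ^ a * unity_root m ((m - 1) * j) ^ b) =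
    (if m dvd t * a \<and> m dvd a + (m - 1) * b then of_nat m * of_nat m else 0)"
proof -
  have "(\<Sum>j<m. \<Sum>k<m. unity_root m (j + t * k) ^ a * unity_root m ((m - 1) * j) ^ b) =
     (\<Sum>j<m. \<Sum>k<m. unity_root m ((a + (m - 1) * b) * j) * unity_root m (t * a * k))"
    unfolding unity_root_power unity_root_mult by (simp add: ring_distribs mult_ac add_ac)
  also have "\<dots> = (\<Sum>j<m. unity_root m ((a + (m - 1) * b) * j)) * (\<Sum>k<m. unity_root m (t * a * k))"
    by (simp add: sum_product)
  finally show ?thesis by (simp add: sum_unity_root[OF assms])
qed

text \<open>Averaging over \<open>G(m,t,2)\<close> turns a polynomial approximation on the bidisc into one by
  invariant polynomials, which are polynomials in the basic invariants.\<close>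
lemma invariant_polynomial_approximation:
  fixes h :: "complex \<times> complex \<Rightarrow> complex"
  assumes t: "t dvd m" "t > 0" "m > 0"
    and hol1: "\<And>y. y \<in> ball 0 1 \<Longrightarrow> (\<lambda>x. h (basic_map m t (x, y))) holomorphic_on ball 0 1"
    and hol2: "\<And>x. x \<in> ball 0 1 \<Longrightarrow> (\<lambda>y. h (basic_map m t (x, y))) holomorphic_on ball 0 1"
    and B: "\<And>x y. x \<in> ball 0 1 \<Longrightarrow> y \<in> ball 0 1 \<Longrightarrow> cmod (h (basic_map m t (x, y))) \<le> B"
    and s: "0 < s" "s < 1" and \<epsilon>: "\<epsilon> > 0"
  obtains N where "poly2 N" "\<And>x y. cmod x \<le> s \<Longrightarrow> cmod y \<le> s \<Longrightarrow>
       cmod (h (basic_map m t (x, y)) - N (basic_map m t (x, y))) \<le> \<epsilon>"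
proof -
  obtain L :: nat and c where c: "\<And>x y. cmod x \<le> s \<Longrightarrow> cmod y \<le> s \<Longrightarrow>
      cmod (h (basic_map m t (x, y)) - (\<Sum>a<L. \<Sum>b<L. c a b * x ^ a * y ^ b)) < \<epsilon>"
    using polydisc_polynomial_approximation[where g = "\<lambda>x y. h (basic_map m t (x, y))",
        OF hol1 hol2 B s \<epsilon>] by blast
  define e where "e a b = (if m dvd t * a \<and> m dvd a + (m - 1) * b then 1 else 0 :: complex)" for a b
  define P where "P x y = (\<Sum>a<L. \<Sum>b<L. c a b * x ^ a * y ^ b)" for x y
  define A where "A x y = (\<Sum>a<L. \<Sum>b<L. c a b * e a b * x ^ a * y ^ b)" for x y
  have A: "of_nat m * of_nat m * A x y =
      (\<Sum>j<m. \<Sum>k<m. P (unity_root m (j + t * k) * x) (unity_root m ((m - 1) * j) * y))" for x y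
  proof -
    have "(\<Sum>j<m. \<Sum>k<m. P (unity_root m (j + t * k) * x) (unity_root m ((m - 1) * j) * y)) =
      (\<Sum>j<m. \<Sum>k<m. \<Sum>a<L. \<Sum>b<L. c a b * x ^ a * y ^ b *
        (unity_root m (j + t * k) ^ a * unity_root m ((m - 1) * j) ^ b))"
      unfolding P_def by (intro sum.cong refl) (simp add: power_mult_distrib)
    also have "\<dots> = (\<Sum>a<L. \<Sum>b<L. \<Sum>j<m. \<Sum>k<m. c a b * x ^ a * y ^ b *
        (unity_root m (j + t * k) ^ a * unity_root m ((m - 1) * j) ^ b))"
      by (rule sum_swap_pairs)
    also have "\<dots> = (\<Sum>a<L. \<Sum>b<L. c a b * x ^ a * y ^ b * (of_nat m * of_nat m * e a b))"
      unfolding sum_distrib_left[symmetric] unity_root_double_average[OF t(3)] e_def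
      by (intro sum.cong refl) simp
    also have "\<dots> = of_nat m * of_nat m * A x y"
      by (simp add: A_def sum_distrib_left mult_ac)
    finally show ?thesis by simp
  qed
  have errA: "cmod (h (basic_map m t (x, y)) - A x y) \<le> \<epsilon>" if x: "cmod x \<le> s" and y: "cmod y \<le> s" for x y
  proof -
    have "of_nat m * of_nat m * (h (basic_map m t (x, y)) - A x y) =
      (\<Sum>j<m. \<Sum>k<m. h (basic_map m t (x, y)) -
         P (unity_root m (j + t * k) * x) (unity_root m ((m - 1) * j) * y))"
      unfolding right_diff_distrib A by (simp add: sum_subtractf)
    also have "cmod \<dots> \<le> (\<Sum>j<m. \<Sum>k<m. \<epsilon>)"
    proof (intro sum_norm_le)
      fix j k
      \<comment> \<open>The group element changes neither the moduli of the coordinates nor the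
        value of \<open>basic_map\<close>, so the same approximation applies at the moved
        point.\<close>
      show "cmod (h (basic_map m t (x, y)) -
         P (unity_root m (j + t * k) * x) (unity_root m ((m - 1) * j) * y)) \<le> \<epsilon>"
        using c[of "unity_root m (j + t * k) * x" "unity_root m ((m - 1) * j) * y",
            unfolded basic_map_invariant[OF t(1,3)]] x y
        by (simp add: norm_mult P_def)
    qed
    finally have "real m * real m * cmod (h (basic_map m t (x, y)) - A x y) \<le> real m * real m * \<epsilon>"
      by (simp add: norm_mult)
    then show ?thesis using t by simp
  qed
  have "\<forall>a b. \<exists>N. poly2 N \<and> (\<forall>x y. N (basic_map m t (x, y)) = e a b * (x ^ a * y ^ b + y ^ a * x ^ b))"
  proof (intro allI)
    fix a b
    show "\<exists>N. poly2 N \<and> (\<forall>x y. N (basic_map m t (x, y)) = e a b * (x ^ a * y ^ b + y ^ a * x ^ b))"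
    proof (cases "m dvd t * a \<and> m dvd a + (m - 1) * b")
      case True
      then show ?thesis using symmetric_monomial_poly2[OF t] by (simp add: e_def)
    next
      case False
      then have "e a b = 0" unfolding e_def by (rule if_not_P)
      then show ?thesis by (intro exI[of _ "\<lambda>p. 0"]) (simp add: poly2_const)
    qed
  qed
  then obtain N where N: "\<And>a b. poly2 (N a b)"
    "\<And>a b x y. N a b (basic_map m t (x, y)) = e a b * (x ^ a * y ^ b + y ^ a * x ^ b)"
    by metis
  show thesis
  \<comment> \<open>The swap is averaged as well: \<open>N a b\<close> carries both orderings of a
    monomial, hence the factor one half.\<close>
  proof (rule that[of "\<lambda>p. \<Sum>a<L. \<Sum>b<L. c a b / 2 * N a b p"])
    show "poly2 (\<lambda>p. \<Sum>a<L. \<Sum>b<L. c a b / 2 * N a b p)" by (intro poly2_intros N)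
    fix x y :: complex assume x: "cmod x \<le> s" and y: "cmod y \<le> s"
    have "(\<Sum>a<L. \<Sum>b<L. c a b / 2 * N a b (basic_map m t (x, y))) = (A x y + A y x) / 2"
      by (simp add: A_def N sum_divide_distrib algebra_simps sum.distrib add_divide_distrib)
    then have "h (basic_map m t (x, y)) - (\<Sum>a<L. \<Sum>b<L. c a b / 2 * N a b (basic_map m t (x, y))) =
        ((h (basic_map m t (x, y)) - A x y) + (h (basic_map m t (x, y)) - A y x)) / 2"
      by (simp add: field_simps)
    also have "cmod \<dots> \<le> (\<epsilon> + \<epsilon>) / 2"
      using norm_triangle_mono[OF errA[OF x y] errA[OF y x, unfolded basic_map_swap[of m t y x]]]
      by (simp only: norm_divide norm_numeral divide_right_mono zero_le_numeral)
    finally show "cmod (h (basic_map m t (x, y)) - (\<Sum>a<L. \<Sum>b<L. c a b / 2 * N a b (basic_map m t (x, y)))) \<le> \<epsilon>"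
      by simp
  qed
qed

section \<open>The Schur-Agler class and the basic map\<close>

text \<open>For fixed moduli \<open>a\<close> and \<open>b\<close>, the difference of the squared
  moduli decreases in \<open>Re u\<close> and \<open>Re v\<close>. The worst case is
  \<open>u = a\<close>, \<open>v = b\<close>, where it factors as
  \<open>4 (1 - a b) (1 - a) (1 - b)\<close>.\<close>

lemma psi_numerator_le_denominator:
  fixes u v :: complex
  assumes "cmod u \<le> 1" "cmod v \<le> 1"
  shows "cmod (2 * u * v - (u + v)) \<le> cmod (2 - (u + v))"
proof -
  define a b where "a = cmod u" and "b = cmod v"
  have ab: "0 \<le> a" "a \<le> 1" "0 \<le> b" "b \<le> 1" using assms by (auto simp: a_def b_def)
  have a2: "a\<^sup>2 = (Re u)\<^sup>2 + (Im u)\<^sup>2" and b2: "b\<^sup>2 = (Re v)\<^sup>2 + (Im v)\<^sup>2"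
    by (simp_all add: a_def b_def cmod_power2)
  have "(cmod (2 - (u + v)))\<^sup>2 - (cmod (2 * u * v - (u + v)))\<^sup>2 =
      4 * ((1 - a\<^sup>2 * b\<^sup>2) - Re u * (1 - b\<^sup>2) - Re v * (1 - a\<^sup>2))"
    unfolding cmod_power2 a2 b2 by (simp add: power2_eq_square algebra_simps)
  moreover have "Re u * (1 - b\<^sup>2) \<le> a * (1 - b\<^sup>2)"
    using ab complex_Re_le_cmod[of u] by (intro mult_right_mono) (auto simp: a_def[symmetric] abs_square_le_1)
  moreover have "Re v * (1 - a\<^sup>2) \<le> b * (1 - a\<^sup>2)"
    using ab complex_Re_le_cmod[of v] by (intro mult_right_mono) (auto simp: b_def[symmetric] abs_square_le_1)
  moreover have "(1 - a\<^sup>2 * b\<^sup>2) - a * (1 - b\<^sup>2) - b * (1 - a\<^sup>2) = (1 - a * b) * ((1 - a) * (1 - b))"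
    by (simp add: power2_eq_square algebra_simps)
  moreover have "0 \<le> (1 - a * b) * ((1 - a) * (1 - b))"
    using ab by (intro mult_nonneg_nonneg) (auto simp: mult_le_one)
  ultimately have "0 \<le> (cmod (2 - (u + v)))\<^sup>2 - (cmod (2 * u * v - (u + v)))\<^sup>2"
    by (smt (verit))
  then have "(cmod (2 * u * v - (u + v)))\<^sup>2 \<le> (cmod (2 - (u + v)))\<^sup>2" by simp
  then show ?thesis by (rule power2_le_imp_le) simp
qed

text \<open>With \<open>u = \<beta> x^m\<close> and \<open>v = \<beta> y^m\<close>, the denominator
  is \<open>2 - (u + v)\<close>, and multiplying the numerator by the unimodular
  \<open>\<beta>\<close> gives \<open>2 u v - (u + v)\<close>.\<close>

lemma psi_norm_le:
  assumes t: "t dvd m" and p: "p \<in> theta_bidisc m t" and \<psi>: "\<psi> \<in> Psi t"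
  shows "cmod (\<psi> p) \<le> 1"
proof -
  obtain x y where p: "p = basic_map m t (x, y)" and xy: "cmod x < 1" "cmod y < 1"
    using p by (auto simp: theta_bidisc_def)
  obtain \<beta> where \<psi>: "\<psi> = psi t \<beta>" and \<beta>: "cmod \<beta> = 1" using \<psi> by (auto simp: Psi_def)
  have 1: "\<psi> p = (2 * \<beta> * (x ^ m * y ^ m) - (x ^ m + y ^ m)) / (2 - \<beta> * (x ^ m + y ^ m))"
    using snd_basic_map_power[OF t, of x y] by (simp add: \<psi> p psi_def basic_map_Pair)
  have "cmod (2 * \<beta> * (x ^ m * y ^ m) - (x ^ m + y ^ m)) =
      cmod (\<beta> * (2 * \<beta> * (x ^ m * y ^ m) - (x ^ m + y ^ m)))"
    using \<beta> by (simp add: norm_mult)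
  also have "\<dots> = cmod (2 * (\<beta> * x ^ m) * (\<beta> * y ^ m) - (\<beta> * x ^ m + \<beta> * y ^ m))"
    by (simp add: algebra_simps)
  also have "\<dots> \<le> cmod (2 - (\<beta> * x ^ m + \<beta> * y ^ m))"
    using xy \<beta> by (intro psi_numerator_le_denominator) (auto simp: norm_mult norm_power power_le_one)
  finally show ?thesis
    unfolding 1 norm_divide by (intro divide_le_eq_1[THEN iffD2]) (auto simp: algebra_simps)
qed

lemma cinner_vec_sum_left: "cinner_vec (\<Sum>i\<in>I. u i) v = (\<Sum>i\<in>I. cinner_vec (u i) v)"
  by (simp add: cinner_vec_def sum_distrib_right sum.swap[of _ I])

lemma cinner_vec_sum_right: "cinner_vec v (\<Sum>i\<in>I. u i) = (\<Sum>i\<in>I. cinner_vec v (u i))"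
  by (simp add: cinner_vec_def sum_distrib_left sum.swap[of _ I])

lemma cinner_vec_scale: "cinner_vec (c *s u) v = c * cinner_vec u v"
  by (simp add: cinner_vec_def sum_distrib_left mult.assoc)

lemma Re_cinner_vec: "Re (cinner_vec u v) = inner u v"
  by (simp add: cinner_vec_def inner_vec_def inner_complex_def)

lemma cinner_vec_self: "cinner_vec v v \<in> \<real>\<^sub>\<ge>\<^sub>0"
proof -
  have "cinner_vec v v = of_real (\<Sum>i\<in>UNIV. (cmod (v $ i))\<^sup>2)"
    unfolding cinner_vec_def by (simp only: of_real_sum complex_norm_square)
  then show ?thesis by (simp only: nonneg_Reals_of_real_iff) (simp add: sum_nonneg)
qed

lemma cnj_cinner_vec: "cnj (cinner_vec u v) = cinner_vec v u"
  by (simp add: cinner_vec_def mult.commute)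

lemma cinner_vec_mat_adj: "cinner_vec (mat_adj A *v u) v = cinner_vec u (A *v v)"
  unfolding cinner_vec_def matrix_vector_mult_def mat_adj_def
  by (simp add: sum_distrib_left sum_distrib_right) (subst sum.swap, simp add: mult_ac)

text \<open>The kernel supported at the single point \<open>p\<close> is admissible; testing \<open>f\<close> against it gives
  the bound for \<open>f p\<close>.\<close>
lemma schur_agler_contraction:
  fixes f :: "'x \<Rightarrow> complex^'n^'n"
  assumes f: "f \<in> schur_agler X \<Psi>" and p: "p \<in> X" and \<psi>: "\<And>\<psi>. \<psi> \<in> \<Psi> \<Longrightarrow> cmod (\<psi> p) \<le> 1"
  shows "norm (f p *v v) \<le> norm v"
proof -
  define S where "S = {C. H_inf_bound X \<Psi> f C}"
  obtain C0 where C0: "C0 \<in> S" using f by (auto simp: schur_agler_def H_inf_def S_def)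
  \<comment> \<open>\<open>LEAST\<close> on the reals is informative only if a least element exists;
    closedness provides it as the infimum.\<close>
  have "closed S"
  proof -
    have "S = {0..} \<inter> (\<Inter>k\<in>admissible_kernels X \<Psi>. \<Inter>r. \<Inter>x\<in>{x::nat \<Rightarrow> 'x. \<forall>i<(r::nat). x i \<in> X}. \<Inter>w::nat \<Rightarrow> complex^'n.
      {C. (\<Sum>i<r. \<Sum>j<r. cinner_vec ((C\<^sup>2 *\<^sub>R k (x i) (x j) - f (x i) ** k (x i) (x j) ** mat_adj (f (x j))) *v w j) (w i)) \<in> \<real>\<^sub>\<ge>\<^sub>0})"
      by (auto simp: S_def H_inf_bound_def pos_kernel_on_def)
    moreover have "closed {C. (\<Sum>i<r. \<Sum>j<r. cinner_vec ((C\<^sup>2 *\<^sub>R k (x i) (x j) - f (x i) ** k (x i) (x j) ** mat_adj (f (x j))) *v w j) (w i)) \<in> \<real>\<^sub>\<ge>\<^sub>0}"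
      for k and r :: nat and x :: "nat \<Rightarrow> 'x" and w :: "nat \<Rightarrow> complex^'n"
    proof -
      have "continuous_on UNIV (\<lambda>C. \<Sum>i<r. \<Sum>j<r. cinner_vec ((C\<^sup>2 *\<^sub>R k (x i) (x j) - f (x i) ** k (x i) (x j) ** mat_adj (f (x j))) *v w j) (w i))"
        unfolding cinner_vec_def matrix_vector_mult_def
        by (auto intro!: continuous_intros)
      from continuous_closed_vimage[OF closed_nonneg_Reals_complex, of "\<lambda>C. \<Sum>i<r. \<Sum>j<r. cinner_vec ((C\<^sup>2 *\<^sub>R k (x i) (x j) - f (x i) ** k (x i) (x j) ** mat_adj (f (x j))) *v w j) (w i)"] this
      show ?thesis by (simp add: vimage_def continuous_on_eq_continuous_at)
    qed
    ultimately show ?thesis by (auto intro!: closed_Int closed_INT)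
  qed
  moreover have "bdd_below S" by (auto simp: S_def H_inf_bound_def bdd_below_def)
  ultimately have Inf: "Inf S \<in> S" using C0 by (intro closed_contains_Inf) auto
  moreover have "H_inf_const X \<Psi> f = Inf S"
    unfolding H_inf_const_def
    by (rule Least_equality) (use Inf \<open>bdd_below S\<close> in \<open>auto simp: S_def intro: cInf_lower\<close>)
  ultimately obtain C where C: "H_inf_bound X \<Psi> f C" "C \<le> 1" "0 \<le> C"
    using f by (auto simp: schur_agler_def S_def H_inf_bound_def)
  define k :: "'x \<Rightarrow> 'x \<Rightarrow> complex^'n^'n" where
    "k = (\<lambda>x y. cscale (indicator {p} x * indicator {p} y) (mat 1))"
  \<comment> \<open>The factor \<open>c\<close> covers both conditions at once: \<open>c = 1\<close>
    for \<open>k\<close> itself and \<open>c = 1 - |\<psi> p|^2\<close> for its weighted version,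
    since \<open>k\<close> lives only at \<open>(p, p)\<close>.\<close>
  have pos: "pos_kernel_on X (\<lambda>x y. cscale c (k x y))" if c: "c \<in> \<real>\<^sub>\<ge>\<^sub>0" for c
    unfolding pos_kernel_on_def
  proof (intro allI impI)
    fix r :: nat and x :: "nat \<Rightarrow> 'x" and w :: "nat \<Rightarrow> complex^'n"
    have 1: "cinner_vec (cscale c (k (x i) (x j)) *v w j) (w i) =
        c * cinner_vec (indicator {p} (x j) *s w j) (indicator {p} (x i) *s w i)" for i j
      by (auto simp: k_def cscale_vector_mult cinner_vec_scale indicator_def cinner_vec_def sum_distrib_left mult.assoc)
    have "(\<Sum>i<r. \<Sum>j<r. cinner_vec (cscale c (k (x i) (x j)) *v w j) (w i)) =
        c * cinner_vec (\<Sum>j<r. indicator {p} (x j) *s w j) (\<Sum>i<r. indicator {p} (x i) *s w i)"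
      unfolding 1 cinner_vec_sum_left cinner_vec_sum_right sum_distrib_left by (rule refl)
    also have "\<dots> \<in> \<real>\<^sub>\<ge>\<^sub>0" by (intro nonneg_Reals_mult_I c cinner_vec_self)
    finally show "(\<Sum>i<r. \<Sum>j<r. cinner_vec (cscale c (k (x i) (x j)) *v w j) (w i)) \<in> \<real>\<^sub>\<ge>\<^sub>0" .
  qed
  have "k \<in> admissible_kernels X \<Psi>"
    unfolding admissible_kernels_def
  proof (intro CollectI conjI ballI)
    have "cscale 1 (k x y) = k x y" for x y by (simp add: cscale_def vec_eq_iff)
    then show "pos_kernel_on X k" using pos[of 1] by simp
    fix \<psi> assume "\<psi> \<in> \<Psi>"
    then have "(cmod (\<psi> p))\<^sup>2 \<le> 1" using \<psi> by (simp add: power_le_one)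
    moreover have "1 - \<psi> p * cnj (\<psi> p) = of_real (1 - (cmod (\<psi> p))\<^sup>2)"
      by (simp only: of_real_diff of_real_1 complex_norm_square)
    ultimately have "1 - \<psi> p * cnj (\<psi> p) \<in> \<real>\<^sub>\<ge>\<^sub>0" by (simp only: nonneg_Reals_of_real_iff)
    moreover have "(\<lambda>x y. cscale (1 - \<psi> x * cnj (\<psi> y)) (k x y)) = (\<lambda>x y. cscale (1 - \<psi> p * cnj (\<psi> p)) (k x y))"
      by (auto simp: fun_eq_iff k_def cscale_def vec_eq_iff indicator_def)
    ultimately show "pos_kernel_on X (\<lambda>x y. cscale (1 - \<psi> x * cnj (\<psi> y)) (k x y))"
      using pos by simp
  qed
  with C have "pos_kernel_on X (\<lambda>x y. C\<^sup>2 *\<^sub>R k x y - f x ** k x y ** mat_adj (f y))"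
    by (simp add: H_inf_bound_def)
  then have P: "cinner_vec ((C\<^sup>2 *\<^sub>R k p p - f p ** k p p ** mat_adj (f p)) *v w) w \<in> \<real>\<^sub>\<ge>\<^sub>0" for w
    unfolding pos_kernel_on_def using p
    by (auto dest!: spec[of _ 1] spec[of _ "\<lambda>_. p"] spec[of _ "\<lambda>_. w"])
  have kp: "k p p = mat 1" by (simp add: k_def cscale_def vec_eq_iff)
  have adj: "norm (mat_adj (f p) *v w) \<le> norm w" for w
  proof -
    have "0 \<le> inner ((C\<^sup>2 *\<^sub>R mat 1 - f p ** mat_adj (f p)) *v w) w"
      using P[of w] unfolding kp matrix_mul_rid by (metis Re_cinner_vec complex_nonneg_Reals_iff)
    also have "\<dots> = C\<^sup>2 * (norm w)\<^sup>2 - (norm (mat_adj (f p) *v w))\<^sup>2"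
      by (simp add: matrix_vector_mult_diff_rdistrib scaleR_vector_mult inner_diff_left
          inner_mat_adj_right dot_square_norm flip: matrix_vector_mul_assoc)
    also have "\<dots> \<le> 1 * (norm w)\<^sup>2 - (norm (mat_adj (f p) *v w))\<^sup>2"
      using C by (intro diff_right_mono mult_right_mono) (auto simp: power_le_one)
    finally show ?thesis by (simp add: power2_le_iff_abs_le)
  qed
  \<comment> \<open>The one-point test bounds \<open>f p ** mat_adj (f p)\<close>, hence the
    adjoint; Cauchy-Schwarz transfers the bound to \<open>f p\<close>.\<close>
  have "norm (f p *v v) * norm (f p *v v) = inner v (mat_adj (f p) *v (f p *v v))"
    by (simp add: inner_mat_adj_right[symmetric] dot_square_norm power2_eq_square[symmetric])
  also have "\<dots> \<le> norm v * norm (f p *v v)"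
    by (rule order_trans[OF norm_cauchy_schwarz]) (simp add: adj mult_left_mono)
  finally show ?thesis by (cases "f p *v v = 0") simp_all
qed

section \<open>Holomorphy of the pull-back to the bidisc\<close>

lemma basic_map_has_derivative:
  "(basic_map m t has_derivative
     (\<lambda>h. (of_nat m * fst z ^ (m - 1) * fst h + of_nat m * snd z ^ (m - 1) * snd h,
       of_nat (m div t) * (fst z * snd z) ^ (m div t - 1) * (fst z * snd h + fst h * snd z)))) (at z within S)"
  unfolding basic_map_def split_def
  by (auto intro!: derivative_eq_intros simp: fun_eq_iff algebra_simps; cases "m div t"; simp add: algebra_simps)

lemma continuous_on_basic_map: "continuous_on S (basic_map m t)"
  unfolding basic_map_def split_def by (intro continuous_intros)

text \<open>The derivative of \<open>f\<close> is taken within the image, so the chain rule is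
  applied relative to the bidisc; openness of the bidisc then makes the result an ordinary
  derivative, to be restricted to coordinate discs.\<close>

lemma holomorphic2_on_compose:
  fixes f :: "complex \<times> complex \<Rightarrow> complex^'n^'n"
  assumes f: "holomorphic2_on f (theta_bidisc m t)"
  shows "y \<in> ball 0 1 \<Longrightarrow> (\<lambda>x. f (basic_map m t (x, y)) $ i $ j) holomorphic_on ball 0 1"
    and "x \<in> ball 0 1 \<Longrightarrow> (\<lambda>y. f (basic_map m t (x, y)) $ i $ j) holomorphic_on ball 0 1"
    and "continuous_on (ball 0 1 \<times> ball 0 1) (\<lambda>z. f (basic_map m t z))"
proof -
  let ?D = "ball (0::complex) 1 \<times> ball (0::complex) 1"
  have D: "\<exists>a b. ((\<lambda>z. f (basic_map m t z)) has_derivative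
      (\<lambda>h. cscale (fst h) a + cscale (snd h) b)) (at z)" if z: "z \<in> ?D" for z
  proof -
    have "basic_map m t z \<in> theta_bidisc m t" using z by (auto simp: theta_bidisc_def)
    then obtain A B where AB: "(f has_derivative (\<lambda>h. cscale (fst h) A + cscale (snd h) B))
        (at (basic_map m t z) within basic_map m t ` ?D)"
      using f unfolding holomorphic2_on_def theta_bidisc_def by blast
    have "((\<lambda>z. f (basic_map m t z)) has_derivative (\<lambda>h. cscale (fst h)
        (cscale (of_nat m * fst z ^ (m - 1)) A + cscale (of_nat (m div t) * (fst z * snd z) ^ (m div t - 1) * snd z) B)
       + cscale (snd h) (cscale (of_nat m * snd z ^ (m - 1)) A +
          cscale (of_nat (m div t) * (fst z * snd z) ^ (m div t - 1) * fst z) B)))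
      (at z within ?D)"
      by (rule has_derivative_eq_rhs[OF has_derivative_in_compose[OF basic_map_has_derivative AB]])
        (simp add: fun_eq_iff cscale_def vec_eq_iff algebra_simps)
    moreover have "at z within ?D = at z" using z by (intro at_within_open) (auto intro: open_Times)
    ultimately show ?thesis by auto
  qed
  then show "continuous_on ?D (\<lambda>z. f (basic_map m t z))"
    by (meson continuous_at_imp_continuous_on has_derivative_continuous)
  show "(\<lambda>x. f (basic_map m t (x, y)) $ i $ j) holomorphic_on ball 0 1" if y: "y \<in> ball 0 1" for y
    unfolding holomorphic_on_open[OF open_ball]
  proof
    fix x assume x: "x \<in> ball (0::complex) 1"
    obtain a b where ab: "((\<lambda>z. f (basic_map m t z)) has_derivative
      (\<lambda>h. cscale (fst h) a + cscale (snd h) b)) (at (x, y))" using D[of "(x, y)"] x y by auto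
    have "((\<lambda>x. (x, y)) has_derivative (\<lambda>h. (h, 0))) (at x)" by (auto intro!: derivative_eq_intros)
    from has_derivative_compose[OF this ab]
    have "((\<lambda>x. f (basic_map m t (x, y)) $ i $ j) has_derivative (\<lambda>h. (cscale h a + cscale 0 b) $ i $ j)) (at x)"
      by (intro bounded_linear.has_derivative[OF bounded_linear_vec_nth]) simp
    then show "\<exists>d. ((\<lambda>x. f (basic_map m t (x, y)) $ i $ j) has_field_derivative d) (at x)"
      by (auto simp: has_field_derivative_def cscale_def mult_commute_abs intro!: exI[of _ "a $ i $ j"])
  qed
  show "(\<lambda>y. f (basic_map m t (x, y)) $ i $ j) holomorphic_on ball 0 1" if x: "x \<in> ball 0 1" for x
    unfolding holomorphic_on_open[OF open_ball]
  proof
    fix y assume y: "y \<in> ball (0::complex) 1"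
    obtain a b where ab: "((\<lambda>z. f (basic_map m t z)) has_derivative
      (\<lambda>h. cscale (fst h) a + cscale (snd h) b)) (at (x, y))" using D[of "(x, y)"] x y by auto
    have "((\<lambda>y. (x, y)) has_derivative (\<lambda>h. (0, h))) (at y)" by (auto intro!: derivative_eq_intros)
    from has_derivative_compose[OF this ab]
    have "((\<lambda>y. f (basic_map m t (x, y)) $ i $ j) has_derivative (\<lambda>h. (cscale 0 a + cscale h b) $ i $ j)) (at y)"
      by (intro bounded_linear.has_derivative[OF bounded_linear_vec_nth]) simp
    then show "\<exists>d. ((\<lambda>y. f (basic_map m t (x, y)) $ i $ j) has_field_derivative d) (at y)"
      by (auto simp: has_field_derivative_def cscale_def mult_commute_abs intro!: exI[of _ "b $ i $ j"])
  qed
qed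

section \<open>The minimum principle for reflected quotients\<close>

text \<open>The one-variable principle is used twice: in \<open>x\<close> for unimodular second
  coordinate, then in \<open>y\<close> for arbitrary \<open>x\<close>.\<close>

lemma bidisc_Re_nonneg:
  fixes g :: "complex \<Rightarrow> complex \<Rightarrow> complex"
  assumes hol1: "\<And>y. y \<in> cball 0 1 \<Longrightarrow> (\<lambda>x. g x y) holomorphic_on cball 0 1"
    and hol2: "\<And>x. x \<in> cball 0 1 \<Longrightarrow> (\<lambda>y. g x y) holomorphic_on cball 0 1"
    and nonneg: "\<And>x y. cmod x = 1 \<Longrightarrow> cmod y = 1 \<Longrightarrow> 0 \<le> Re (g x y)"
    and x: "x \<in> cball 0 1" and y: "y \<in> cball 0 1"
  shows "0 \<le> Re (g x y)"
proof -
  have disc: "0 \<le> Re (u z)" if u: "u holomorphic_on cball 0 1"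
    and n: "\<And>z. cmod z = 1 \<Longrightarrow> 0 \<le> Re (u z)" and z: "z \<in> cball 0 1" for u :: "complex \<Rightarrow> complex" and z
  proof -
    have "Re (- u z) \<le> 0"
      by (rule maximum_real_frontier[where S = "cball 0 1"])
        (use u n z in \<open>auto intro!: holomorphic_intros continuous_intros
          holomorphic_on_imp_continuous_on intro: holomorphic_on_subset\<close>)
    then show ?thesis by simp
  qed
  have "0 \<le> Re (g x \<eta>)" if "cmod \<eta> = 1" for \<eta>
    by (rule disc[where u = "\<lambda>x. g x \<eta>"]) (use that hol1 nonneg x in auto)
  then show ?thesis by (rule disc[where u = "\<lambda>y. g x y", OF hol2[OF x] _ y])
qed

text \<open>On the torus, multiplying \<open>cnj x ^ m + cnj y ^ m\<close> by
  \<open>x ^ m * y ^ m\<close> merely exchanges the two summands.\<close>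

lemma basic_map_torus:
  assumes "t dvd m" "cmod x = 1" "cmod y = 1"
  shows "cmod (snd (basic_map m t (x, y))) = 1"
    and "cnj (fst (basic_map m t (x, y))) * snd (basic_map m t (x, y)) ^ t = fst (basic_map m t (x, y))"
proof -
  show "cmod (snd (basic_map m t (x, y))) = 1"
    using assms by (simp add: basic_map_Pair norm_power norm_mult)
  have 1: "cnj u ^ m * (u ^ m * w) = w" if "cmod u = 1" for u w
  proof -
    have "cnj u * u = 1" using complex_norm_square[of u] that by (simp add: mult.commute)
    then show ?thesis by (simp flip: mult.assoc power_mult_distrib)
  qed
  have "cnj (fst (basic_map m t (x, y))) * snd (basic_map m t (x, y)) ^ t =
      cnj x ^ m * (x ^ m * y ^ m) + cnj y ^ m * (y ^ m * x ^ m)"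
    unfolding snd_basic_map_power[OF assms(1)] by (simp add: basic_map_Pair algebra_simps)
  then show "cnj (fst (basic_map m t (x, y))) * snd (basic_map m t (x, y)) ^ t = fst (basic_map m t (x, y))"
    using assms by (simp add: 1 basic_map_Pair)
qed

lemma snd_basic_map_norm_le:
  assumes "t dvd m" "m > 0" "cmod x \<le> s" "cmod y \<le> s" "s \<le> 1"
  shows "cmod (snd (basic_map m t (x, y))) \<le> s"
proof -
  have s: "0 \<le> s" using assms norm_ge_zero order_trans by blast
  have l: "0 < m div t" using assms by (auto simp: dvd_def)
  have "cmod (x * y) \<le> s * 1" using assms s by (simp only: norm_mult) (intro mult_mono, auto)
  then have "cmod (x * y) ^ (m div t) \<le> s ^ (m div t)" by (intro power_mono) auto
  also have "\<dots> \<le> s ^ 1" using l s assms by (intro power_decreasing) auto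
  finally show ?thesis by (simp add: basic_map_Pair norm_power)
qed

text \<open>On the torus \<open>h + w cnj h\<close> over \<open>1 - w\<close> is purely imaginary, but it is singular where
  \<open>w = 1\<close>; replacing \<open>w\<close> by \<open>\<rho> w\<close> makes the minimum principle applicable.\<close>
lemma reflected_quotient_Re_nonneg:
  assumes t: "t dvd m" "m > 0" and k: "k > 0"
    and h: "poly2 h" and j: "poly2 j"
    and refl: "\<And>x y. cmod x = 1 \<Longrightarrow> cmod y = 1 \<Longrightarrow>
      j (basic_map m t (x, y)) = snd (basic_map m t (x, y)) ^ M * cnj (h (basic_map m t (x, y)))"
    and pos: "\<And>x y. cmod x = 1 \<Longrightarrow> cmod y = 1 \<Longrightarrow> 0 \<le> Re (h (basic_map m t (x, y)))"
    and p: "p \<in> theta_bidisc m t"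
  shows "0 \<le> Re ((h p + snd p ^ k * j p) / (1 - snd p ^ (M + k)))"
proof -
  obtain x y where p: "p = basic_map m t (x, y)" and xy: "x \<in> ball 0 1" "y \<in> ball 0 1"
    using p by (auto simp: theta_bidisc_def)
  have le1: "cmod (snd (basic_map m t (x, y))) \<le> 1" if "x \<in> cball 0 1" "y \<in> cball 0 1" for x y
    using snd_basic_map_norm_le[OF t, of x 1 y] that by simp
  have approx: "0 \<le> Re ((h p + of_real \<rho> * snd p ^ k * j p) / (1 - of_real \<rho> * snd p ^ (M + k)))"
    if \<rho>: "0 < \<rho>" "\<rho> < 1" for \<rho>
  proof -
    define g where "g x y = (let p = (x ^ m + y ^ m, (x * y) ^ (m div t)) in
      (h p + of_real \<rho> * snd p ^ k * j p) / (1 - of_real \<rho> * snd p ^ (M + k)))" for x y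
    have nz: "1 - of_real \<rho> * ((x * y) ^ (m div t)) ^ (M + k) \<noteq> 0" if "x \<in> cball 0 1" "y \<in> cball 0 1" for x y :: complex
    proof
      assume "1 - of_real \<rho> * ((x * y) ^ (m div t)) ^ (M + k) = 0"
      then have "cmod (of_real \<rho> * ((x * y) ^ (m div t)) ^ (M + k)) = 1" by (metis eq_iff_diff_eq_0 norm_one)
      then have "\<rho> * cmod ((x * y) ^ (m div t)) ^ (M + k) = 1" using \<rho> by (simp add: norm_mult norm_power)
      moreover have "cmod ((x * y) ^ (m div t)) ^ (M + k) \<le> 1"
        using le1[OF that] by (intro power_le_one) (auto simp: basic_map_Pair)
      then have "\<rho> * cmod ((x * y) ^ (m div t)) ^ (M + k) \<le> \<rho> * 1" using \<rho> by (intro mult_left_mono) auto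
      ultimately show False using \<rho> by simp
    qed
    have "0 \<le> Re (g x y)"
    proof (rule bidisc_Re_nonneg[where g = g])
      show "(\<lambda>x. g x y) holomorphic_on cball 0 1" if "y \<in> cball 0 1" for y
        unfolding g_def Let_def snd_conv
        by (intro holomorphic_intros poly2_holomorphic[OF h] poly2_holomorphic[OF j] nz that)
      show "(\<lambda>y. g x y) holomorphic_on cball 0 1" if "x \<in> cball 0 1" for x
        unfolding g_def Let_def snd_conv
        by (intro holomorphic_intros poly2_holomorphic[OF h] poly2_holomorphic[OF j] nz that)
      show "x \<in> cball 0 1" "y \<in> cball 0 1" using xy by auto
      fix x y :: complex assume xy: "cmod x = 1" "cmod y = 1"
      define q where "q = basic_map m t (x, y)"
      define w where "w = snd q ^ (M + k)"
      have w: "w * cnj w = 1"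
        using basic_map_torus(1)[OF t(1) xy] complex_norm_square[of w]
        by (simp add: w_def q_def norm_power)
      have "g x y = (h q + of_real \<rho> * snd q ^ k * j q) / (1 - of_real \<rho> * w)"
        by (simp add: g_def Let_def q_def w_def basic_map_Pair)
      also have "of_real \<rho> * snd q ^ k * j q = of_real \<rho> * w * cnj (h q)"
        using refl[OF xy] by (simp add: q_def w_def power_add)
      finally have g: "g x y = (h q + of_real \<rho> * w * cnj (h q)) / (1 - of_real \<rho> * w)" .
      \<comment> \<open>The sign of the quotient is that of numerator times conjugate denominator.
        The two terms linear in \<open>\<rho>\<close> form a number minus its conjugate and drop out
        of the real part.\<close>
      have "Re ((h q + of_real \<rho> * w * cnj (h q)) * cnj (1 - of_real \<rho> * w)) =
          Re (h q) - \<rho>\<^sup>2 * Re (w * cnj w * cnj (h q))"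
        by (simp add: algebra_simps power2_eq_square)
      also have "\<dots> = (1 - \<rho>\<^sup>2) * Re (h q)" by (simp add: w algebra_simps)
      also have "\<dots> \<ge> 0"
        using \<rho> pos[OF xy] by (intro mult_nonneg_nonneg) (auto simp: q_def abs_square_le_1)
      finally show "0 \<le> Re (g x y)" unfolding g Re_complex_div_ge_0 .
    qed
    then show ?thesis by (simp add: g_def Let_def p basic_map_Pair)
  qed
  \<comment> \<open>Inside the domain the denominator stays away from zero even at
    \<open>\<rho> = 1\<close>, so the limit can be taken.\<close>
  have "cmod (snd p) < 1"
    using snd_basic_map_norm_le[OF t, of x "max (cmod x) (cmod y)" y] xy by (auto simp: p)
  then have "cmod (snd p ^ (M + k)) < 1"
    using k by (simp add: norm_power power_Suc_less_one power_less_one_iff)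
  then have nz: "1 - snd p ^ (M + k) \<noteq> 0" by auto
  have "((\<lambda>\<rho>. Re ((h p + of_real \<rho> * snd p ^ k * j p) / (1 - of_real \<rho> * snd p ^ (M + k)))) \<longlongrightarrow>
      Re ((h p + of_real 1 * snd p ^ k * j p) / (1 - of_real 1 * snd p ^ (M + k)))) (at_left 1)"
    using nz by (intro tendsto_intros) auto
  moreover have "eventually (\<lambda>\<rho>. 0 \<le> Re ((h p + of_real \<rho> * snd p ^ k * j p) / (1 - of_real \<rho> * snd p ^ (M + k)))) (at_left 1)"
    using eventually_at_left_real[of 0 1] by (rule eventually_mono) (use approx in auto)
  ultimately show ?thesis
    using tendsto_lowerbound[of _ _ "at_left (1::real)" 0] by simp
qed

lemma accretive_iff_cinner: "accretive A \<longleftrightarrow> (\<forall>v. 0 \<le> Re (cinner_vec (A *v v) v))"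
  by (simp add: accretive_def Re_cinner_vec inner_commute)

lemma poly2_cinner:
  fixes H :: "complex \<times> complex \<Rightarrow> complex^'n^'n"
  assumes "\<And>i j. poly2 (\<lambda>p. H p $ i $ j)"
  shows "poly2 (\<lambda>p. cinner_vec (H p *v v) v)"
  unfolding cinner_vec_def matrix_vector_mult_def
  by (simp add: sum_distrib_right) (intro poly2_intros assms)

text \<open>Testing with a fixed vector \<open>v\<close> reduces to the scalar case, because the
  form of the adjoint at \<open>v\<close> is the conjugate of the form of \<open>H\<close>.\<close>

lemma reflected_quotient_accretive:
  fixes H J :: "complex \<times> complex \<Rightarrow> complex^'n^'n"
  assumes t: "t dvd m" "m > 0" and k: "k > 0"
    and H: "\<And>i j. poly2 (\<lambda>p. H p $ i $ j)" and J: "\<And>i j. poly2 (\<lambda>p. J p $ i $ j)"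
    and refl: "\<And>x y. cmod x = 1 \<Longrightarrow> cmod y = 1 \<Longrightarrow>
      J (basic_map m t (x, y)) = cscale (snd (basic_map m t (x, y)) ^ M) (mat_adj (H (basic_map m t (x, y))))"
    and acc: "\<And>x y. cmod x = 1 \<Longrightarrow> cmod y = 1 \<Longrightarrow> accretive (H (basic_map m t (x, y)))"
    and p: "p \<in> theta_bidisc m t"
  shows "accretive (cscale (1 / (1 - snd p ^ (M + k))) (H p + cscale (snd p ^ k) (J p)))"
  unfolding accretive_iff_cinner
proof
  fix v
  have "0 \<le> Re ((cinner_vec (H p *v v) v + snd p ^ k * cinner_vec (J p *v v) v) / (1 - snd p ^ (M + k)))"
  proof (rule reflected_quotient_Re_nonneg[OF t k poly2_cinner poly2_cinner _ _ p])
    fix x y :: complex assume xy: "cmod x = 1" "cmod y = 1"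
    show "0 \<le> Re (cinner_vec (H (basic_map m t (x, y)) *v v) v)"
      using acc[OF xy] by (simp add: accretive_iff_cinner)
    show "cinner_vec (J (basic_map m t (x, y)) *v v) v = snd (basic_map m t (x, y)) ^ M *
        cnj (cinner_vec (H (basic_map m t (x, y)) *v v) v)"
      by (simp add: refl[OF xy] cscale_vector_mult cinner_vec_scale cinner_vec_mat_adj cnj_cinner_vec)
  qed (rule H J)+
  also have "(cinner_vec (H p *v v) v + snd p ^ k * cinner_vec (J p *v v) v) / (1 - snd p ^ (M + k)) =
      cinner_vec (cscale (1 / (1 - snd p ^ (M + k))) (H p + cscale (snd p ^ k) (J p)) *v v) v"
  proof -
    have "cinner_vec (a + b) v = cinner_vec a v + cinner_vec b v" for a b
      by (simp add: cinner_vec_def algebra_simps sum.distrib)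
    then show ?thesis
      by (simp add: cscale_vector_mult matrix_vector_mult_add_rdistrib cinner_vec_scale add_divide_distrib)
  qed
  finally show "0 \<le> Re (cinner_vec (cscale (1 / (1 - snd p ^ (M + k))) (H p + cscale (snd p ^ k) (J p)) *v v) v)" .
qed

text \<open>A kernel vector is tested against itself. At \<open>w = 1\<close> the matrix is
  \<open>H + H^*\<close>, definite thanks to \<open>c\<close>; elsewhere the part coming from
  \<open>H\<close> is imaginary after multiplication by \<open>cnj (1 - w)\<close>, which leaves
  \<open>|1 - w|^2 |v|^2 = 0\<close>.\<close>

lemma torus_denominator_invertible:
  fixes H :: "complex^'n^'n"
  assumes w: "w * cnj w = 1" and c: "c > 0" "\<And>v. c * (norm v)\<^sup>2 \<le> inner v (H *v v)"
  shows "invertible (cscale (1 - w) (mat 1) + (H + cscale w (mat_adj H)))"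
proof -
  let ?D = "cscale (1 - w) (mat 1) + (H + cscale w (mat_adj H))"
  have "v = 0" if v: "?D *v v = 0" for v
  proof -
    define h where "h = cinner_vec (H *v v) v"
    have add: "cinner_vec (a + b) v = cinner_vec a v + cinner_vec b v" for a b
      by (simp add: cinner_vec_def algebra_simps sum.distrib)
    have "cinner_vec (?D *v v) v = (1 - w) * cinner_vec v v + (h + w * cnj h)"
      by (simp only: matrix_vector_mult_add_rdistrib cscale_vector_mult add cinner_vec_scale h_def
          cinner_vec_mat_adj cnj_cinner_vec matrix_vector_mul_lid)
    then have 0: "(1 - w) * cinner_vec v v + (h + w * cnj h) = 0"
      by (simp add: v cinner_vec_def)
    show "v = 0"
    proof (cases "w = 1")
      case True
      then have "2 * Re h = 0" using arg_cong[OF 0, of Re] by simp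
      then have "inner v (H *v v) = 0" by (simp add: h_def Re_cinner_vec inner_commute)
      then show ?thesis using c(2)[of v] c(1) by (simp add: mult_le_0_iff)
    next
      case False
      have "(1 - w) * cnj (1 - w) * cinner_vec v v + (h - cnj w * h + w * cnj h - w * cnj w * cnj h) =
          ((1 - w) * cinner_vec v v + (h + w * cnj h)) * cnj (1 - w)"
        by (simp add: algebra_simps)
      also have "\<dots> = 0" by (simp only: 0 mult_zero_left)
      finally have "Re ((1 - w) * cnj (1 - w) * cinner_vec v v + (h - cnj w * h + w * cnj h - w * cnj w * cnj h)) = 0"
        by simp
      then have "Re ((1 - w) * cnj (1 - w) * cinner_vec v v) = 0" by (simp add: w)
      then have "(cmod (1 - w))\<^sup>2 * (norm v)\<^sup>2 = 0"
        unfolding complex_norm_square[symmetric]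
        by (simp add: Re_cinner_vec dot_square_norm del: of_real_power)
      then show ?thesis using False by simp
    qed
  qed
  then show ?thesis by (simp add: invertible_left_inverse matrix_left_invertible_ker)
qed

text \<open>The left-hand quotient avoids dividing by \<open>a\<close>: its factors are polynomial
  when \<open>a\<close> and \<open>L\<close> are, and remain meaningful at zeros of
  \<open>a\<close>. Off those zeros the scalar \<open>a\<close> cancels.\<close>

lemma cayley_cscale:
  fixes L :: "complex^'n^'n"
  assumes a: "a \<noteq> 0" and acc: "accretive (cscale (1 / a) L)"
  shows "invertible (cscale a (mat 1) + L)"
    and "(cscale a (mat 1) - L) ** matrix_inv (cscale a (mat 1) + L) = cayley (cscale (1 / a) L)"
proof -
  let ?K = "cscale (1 / a) L"
  have 1: "cscale a (mat 1) + L = cscale a (mat 1 + ?K)" "cscale a (mat 1) - L = cscale a (mat 1 - ?K)"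
    using a by (simp_all add: cscale_def vec_eq_iff algebra_simps)
  have "v = 0" if "(cscale a (mat 1) + L) *v v = 0" for v
  proof -
    have "(mat 1 + ?K) *v v = 0"
      using that a by (simp only: 1 cscale_vector_mult vector_mul_eq_0) simp
    then show "v = 0" using accretive_norm_le[OF acc, of v] by simp
  qed
  then show inv: "invertible (cscale a (mat 1) + L)"
    by (simp add: invertible_left_inverse matrix_left_invertible_ker)
  have "((cscale a (mat 1) - L) ** matrix_inv (cscale a (mat 1) + L)) *v x = cayley ?K *v x" for x
  proof -
    define u where "u = matrix_inv (cscale a (mat 1) + L) *v x"
    have u: "x = (cscale a (mat 1) + L) *v u" by (simp add: u_def matrix_inv_cancel[OF inv])
    have "((cscale a (mat 1) - L) ** matrix_inv (cscale a (mat 1) + L)) *v x = a *s ((mat 1 - ?K) *v u)"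
      by (simp add: u_def matrix_vector_mul_assoc[symmetric]) (simp add: 1(2) cscale_vector_mult)
    also have "\<dots> = a *s (cayley ?K *v ((mat 1 + ?K) *v u))"
      by (simp only: cayley_vector_mult[OF accretive_invertible[OF acc]])
    also have "\<dots> = cayley ?K *v x"
      unfolding u 1(1) cscale_vector_mult mult_vector_scalar ..
    finally show ?thesis .
  qed
  then show "(cscale a (mat 1) - L) ** matrix_inv (cscale a (mat 1) + L) = cayley ?K"
    by (simp add: matrix_eq)
qed

section \<open>Approximation by rational inner functions\<close>

lemma holomorphic_cayley:
  fixes A :: "complex \<Rightarrow> complex^'n^'n"
  assumes A: "\<And>i j. (\<lambda>x. A x $ i $ j) holomorphic_on S"
    and inv: "\<And>x. x \<in> S \<Longrightarrow> invertible (mat 1 + A x)"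
  shows "(\<lambda>x. cayley (A x) $ i $ j) holomorphic_on S"
proof (rule holomorphic_transform)
  have det: "(\<lambda>x. det (B x)) holomorphic_on S" if "\<And>i j. (\<lambda>x. B x $ i $ j) holomorphic_on S"
    for B :: "complex \<Rightarrow> complex^'n^'n"
    unfolding det_def by (intro holomorphic_intros that)
  have B: "(\<lambda>x. (mat 1 + A x) $ i $ j) holomorphic_on S" for i j
    by (simp) (intro holomorphic_intros A)
  have "(\<lambda>x. (\<chi> i l. if l = k then (if i = j then 1 else 0) else (mat 1 + A x) $ i $ l) $ a $ b) holomorphic_on S"
    for k a b
    using B[of a b] by (cases "b = k") simp_all
  then show "(\<lambda>x. \<Sum>k\<in>UNIV. ((mat 1 :: complex^'n^'n) $ i $ k - A x $ i $ k) *
      (det (\<chi> i l. if l = k then (if i = j then 1 else 0) else (mat 1 + A x) $ i $ l) / det (mat 1 + A x)))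
    holomorphic_on S"
    by (intro holomorphic_intros A det B) (auto simp: inv simp flip: invertible_det_nz)
  show "(\<Sum>k\<in>UNIV. ((mat 1 :: complex^'n^'n) $ i $ k - A x $ i $ k) *
      (det (\<chi> i l. if l = k then (if i = j then 1 else 0) else (mat 1 + A x) $ i $ l) / det (mat 1 + A x))) =
      cayley (A x) $ i $ j" if "x \<in> S" for x
    using inv[OF that] unfolding cayley_def matrix_matrix_mult_def invertible_det_nz
    by (simp only: vec_lambda_beta matrix_inv_component vector_minus_component not_False_eq_True)
qed

text \<open>One \<open>r\<close> serves both as contraction factor and as dilation. Treating it as a
  third variable in \<open>[0, 1]\<close> gives a compact domain, where uniform continuity compares
  \<open>r\<close> with 1.\<close>

lemma dilation_approximation:
  fixes g :: "complex \<times> complex \<Rightarrow> 'a::real_normed_vector"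
  assumes g: "continuous_on (ball 0 1 \<times> ball 0 1) g" and s: "0 < s" "s < 1" and \<epsilon>: "\<epsilon> > 0"
  shows "\<exists>r. 0 < r \<and> r < 1 \<and> (\<forall>x y. cmod x \<le> s \<longrightarrow> cmod y \<le> s \<longrightarrow>
    norm (r *\<^sub>R g (of_real r * x, of_real r * y) - g (x, y)) \<le> \<epsilon>)"
proof -
  let ?T = "{0..1::real} \<times> (cball (0::complex) s \<times> cball (0::complex) s)"
  define h where "h q = fst q *\<^sub>R g (of_real (fst q) * fst (snd q), of_real (fst q) * snd (snd q))" for q
  have sub: "cmod (of_real r * x) < 1" if "0 \<le> r" "r \<le> 1" "cmod x \<le> s" for r x
  proof -
    have "cmod (of_real r * x) \<le> 1 * s" unfolding norm_mult using that by (intro mult_mono) auto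
    with s show ?thesis by simp
  qed
  have "continuous_on ?T h"
    unfolding h_def
    by (intro continuous_intros continuous_on_compose2[OF g]) (auto simp: sub)
  then have "uniformly_continuous_on ?T h"
    by (intro compact_uniformly_continuous compact_Times) auto
  then obtain d where d: "d > 0" "\<And>q q'. q \<in> ?T \<Longrightarrow> q' \<in> ?T \<Longrightarrow> dist q' q < d \<Longrightarrow> dist (h q') (h q) < \<epsilon>"
    using \<epsilon> unfolding uniformly_continuous_on_def by metis
  define r where "r = max (1 / 2) (1 - d / 2)"
  have r: "0 < r" "r < 1" "1 - r < d" using d(1) by (auto simp: r_def max_def)
  have "norm (r *\<^sub>R g (of_real r * x, of_real r * y) - g (x, y)) \<le> \<epsilon>" if "cmod x \<le> s" "cmod y \<le> s" for x y
  proof -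
    have "dist (r, x, y) (1, x, y) < d" using r by (simp add: dist_Pair_Pair dist_real_def)
    then have "dist (h (r, x, y)) (h (1, x, y)) < \<epsilon>" using that r by (intro d) auto
    then show ?thesis by (simp add: h_def dist_norm)
  qed
  with r show ?thesis by blast
qed

text \<open>This is properness of the basic map. The preimage of \<open>K\<close> is taken in the
  closed bidisc, where it is compact, and then shown to avoid the boundary, so the larger coordinate
  modulus has a maximum below 1.\<close>

lemma compact_subset_theta_bidisc:
  assumes t: "t dvd m" "m > 0" and K: "compact K" "K \<subseteq> theta_bidisc m t"
  shows "\<exists>s. 0 < s \<and> s < 1 \<and> K \<subseteq> basic_map m t ` (cball 0 s \<times> cball 0 s)"
proof (cases "K = {}")
  case True
  then show ?thesis by (intro exI[of _ "1/2"]) auto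
next
  case False
  let ?B = "cball (0::complex) 1 \<times> cball (0::complex) 1"
  define S where "S = ?B \<inter> basic_map m t -` K"
  have sub: "cmod x < 1" if "(x, y) \<in> S \<or> (y, x) \<in> S" for x y
  proof -
    have "basic_map m t (x, y) \<in> theta_bidisc m t"
      using that K(2) basic_map_swap[of m t x y] by (auto simp: S_def)
    then obtain u v where uv: "basic_map m t (x, y) = basic_map m t (u, v)" "cmod u < 1" "cmod v < 1"
      by (auto simp: theta_bidisc_def)
    have 1: "x ^ m + y ^ m = u ^ m + v ^ m" using uv(1) by (simp add: basic_map_Pair)
    have 2: "x ^ m * y ^ m = u ^ m * v ^ m"
      using snd_basic_map_power[OF t(1), of x y] snd_basic_map_power[OF t(1), of u v] uv(1) by simp
    \<comment> \<open>The point determines the sum and product of the \<open>m\<close>-th powers, so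
      \<open>x ^ m\<close> is a root of the quadratic with roots \<open>u ^ m\<close> and
      \<open>v ^ m\<close>.\<close>
    have "(x ^ m - u ^ m) * (x ^ m - v ^ m) = x ^ m * x ^ m - x ^ m * (u ^ m + v ^ m) + u ^ m * v ^ m"
      by (simp add: algebra_simps)
    also have "\<dots> = 0" unfolding 1[symmetric] 2[symmetric] by (simp add: algebra_simps)
    finally have "x ^ m = u ^ m \<or> x ^ m = v ^ m" by simp
    then have "cmod x ^ m = cmod u ^ m \<or> cmod x ^ m = cmod v ^ m" by (metis norm_power)
    then have "cmod x = cmod u \<or> cmod x = cmod v"
      using t by (metis norm_ge_zero power_eq_imp_eq_base)
    then show ?thesis using uv by auto
  qed
  have "closed K" using K(1) by (rule compact_imp_closed)
  then have "compact S"
    unfolding S_def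
    by (intro compact_Int_closed compact_Times closed_vimage continuous_on_basic_map) auto
  moreover have "S \<noteq> {}"
    using False K(2) by (force simp: S_def theta_bidisc_def)
  moreover have "continuous_on S (\<lambda>z. max (cmod (fst z)) (cmod (snd z)))" by (intro continuous_intros)
  ultimately have "\<exists>z\<in>S. \<forall>z'\<in>S.
      max (cmod (fst z')) (cmod (snd z')) \<le> max (cmod (fst z)) (cmod (snd z))"
    by (rule continuous_attains_sup)
  then obtain z where z: "z \<in> S" "\<And>z'. z' \<in> S \<Longrightarrow>
      max (cmod (fst z')) (cmod (snd z')) \<le> max (cmod (fst z)) (cmod (snd z))"
    by blast
  define s where "s = max (1/2) (max (cmod (fst z)) (cmod (snd z)))"
  have "s < 1" using sub[of "fst z" "snd z"] sub[of "snd z" "fst z"] z(1) by (auto simp: s_def)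
  moreover have "K \<subseteq> basic_map m t ` (cball 0 s \<times> cball 0 s)"
  proof
    fix p assume p: "p \<in> K"
    then obtain x y where xy: "p = basic_map m t (x, y)" "cmod x < 1" "cmod y < 1"
      using K(2) by (auto simp: theta_bidisc_def)
    then have "(x, y) \<in> S" using p by (auto simp: S_def)
    then have "cmod x \<le> s" "cmod y \<le> s" using z(2)[of "(x, y)"] by (auto simp: s_def)
    then show "p \<in> basic_map m t ` (cball 0 s \<times> cball 0 s)" using xy by auto
  qed
  ultimately show ?thesis by (intro exI[of _ s]) (auto simp: s_def)
qed

lemma poly2_matrix_bounded:
  fixes H :: "complex \<times> complex \<Rightarrow> complex^'n^'n"
  assumes "\<And>i j. poly2 (\<lambda>p. H p $ i $ j)" "compact K"
  shows "\<exists>C>0. \<forall>p\<in>K. \<forall>i j. cmod (H p $ i $ j) \<le> C"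
proof -
  have "continuous_on K (\<lambda>p. \<chi> i. \<chi> j. H p $ i $ j)"
    by (intro continuous_on_vec_lambda poly2_continuous assms)
  then have "compact (H ` K)" using assms(2) by (intro compact_continuous_image) simp_all
  then obtain C where "C > 0" "\<And>A. A \<in> H ` K \<Longrightarrow> norm A \<le> C"
    by (meson bounded_pos compact_imp_bounded)
  moreover have "cmod (A $ i $ j) \<le> norm A" for A :: "complex^'n^'n" and i j
    by (rule order_trans[OF Finite_Cartesian_Product.norm_nth_le Finite_Cartesian_Product.norm_nth_le])
  ultimately show ?thesis by (meson imageI order_trans)
qed

lemma rational_inner_approximation_on_polydisc:
  fixes f :: "complex \<times> complex \<Rightarrow> complex^'n^'n"
  assumes t: "t dvd m" "t > 0" "m > 0"
    and hol: "holomorphic2_on f (theta_bidisc m t)"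
    and contr: "\<And>p v. p \<in> theta_bidisc m t \<Longrightarrow> norm (f p *v v) \<le> norm v"
    and s: "0 < s" "s < 1" and \<epsilon>: "\<epsilon> > 0"
  shows "\<exists>\<Phi>. rational_inner m t \<Phi> \<and> (\<forall>p\<in>basic_map m t ` (cball 0 s \<times> cball 0 s). norm (\<Phi> p - f p) \<le> \<epsilon>)"
proof -
  let ?\<theta> = "basic_map m t"
  note holf = holomorphic2_on_compose[OF hol]
  define nn where "nn = real CARD('n) * real CARD('n)"
  have nn: "nn > 0" by (simp add: nn_def)
  obtain r where r: "0 < r" "r < 1" and dil: "\<And>x y. cmod x \<le> s \<Longrightarrow> cmod y \<le> s \<Longrightarrow>
      norm (r *\<^sub>R f (?\<theta> (of_real r * x, of_real r * y)) - f (?\<theta> (x, y))) \<le> \<epsilon> / 2"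
    using dilation_approximation[OF holf(3) s, of "\<epsilon> / 2"] \<epsilon> by auto
  \<comment> \<open>Half of the lower bound \<open>(1 - r^2) / 4\<close> for \<open>F\<close>; the
    other half absorbs the approximation error, as \<open>\<eta> \<le> c\<close>.\<close>
  define c where "c = (1 - r\<^sup>2) / 8"
  have c: "c > 0" using r by (simp add: c_def power_less_one_iff)
  \<comment> \<open>The second bound is the error budget: from \<open>K\<close> to \<open>H\<close>
    and from \<open>H\<close> to the dilated \<open>F\<close> the Cayley transform costs
    \<open>2 * \<eta>\<close> each, and returning to the matrix norm costs \<open>nn\<close>, in
    total at most \<open>\<epsilon> / 2\<close>. The dilation takes the other half.\<close>
  define \<eta> where "\<eta> = min c (\<epsilon> / (8 * nn))"
  have "\<eta> \<le> \<epsilon> / (8 * nn)" unfolding \<eta>_def by (rule min.cobounded2)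
  then have \<eta>\<epsilon>: "nn * (4 * \<eta>) \<le> \<epsilon> / 2" using nn by (simp add: field_simps)
  have \<eta>: "\<eta> > 0" "\<eta> \<le> c" using c \<epsilon> nn by (auto simp: \<eta>_def)
  define \<delta> where "\<delta> = \<eta> / nn"
  have \<delta>: "\<delta> > 0" "nn * \<delta> = \<eta>" using nn \<eta> by (auto simp: \<delta>_def)
  define F where "F p = cayley (r *\<^sub>R f p)" for p
  have inX: "?\<theta> (x, y) \<in> theta_bidisc m t" if "x \<in> ball 0 1" "y \<in> ball 0 1" for x y
    using that by (auto simp: theta_bidisc_def)
  have "\<forall>i j. \<exists>N. poly2 N \<and> (\<forall>x y. cmod x \<le> r \<longrightarrow> cmod y \<le> r \<longrightarrow>
      cmod (F (?\<theta> (x, y)) $ i $ j - N (?\<theta> (x, y))) \<le> \<delta>)"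
  proof (intro allI)
    fix i j
    have "(\<lambda>x. F (?\<theta> (x, y)) $ i $ j) holomorphic_on ball 0 1" if "y \<in> ball 0 1" for y
      unfolding F_def
      by (intro holomorphic_cayley contraction_invertible(2) contr inX that r)
        (auto simp: scaleR_conv_of_real intro!: holomorphic_intros holf(1)[OF that])
    moreover have "(\<lambda>y. F (?\<theta> (x, y)) $ i $ j) holomorphic_on ball 0 1" if "x \<in> ball 0 1" for x
      unfolding F_def
      by (intro holomorphic_cayley contraction_invertible(2) contr inX that r)
        (auto simp: scaleR_conv_of_real intro!: holomorphic_intros holf(2)[OF that])
    moreover have "cmod (F (?\<theta> (x, y)) $ i $ j) \<le> 2 / (1 - r)" if "x \<in> ball 0 1" "y \<in> ball 0 1" for x y
      unfolding F_def by (intro matrix_component_le cayley_contraction(2) contr inX that r)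
    ultimately show "\<exists>N. poly2 N \<and> (\<forall>x y. cmod x \<le> r \<longrightarrow> cmod y \<le> r \<longrightarrow>
      cmod (F (?\<theta> (x, y)) $ i $ j - N (?\<theta> (x, y))) \<le> \<delta>)"
      using invariant_polynomial_approximation[OF t, where h = "\<lambda>p. F p $ i $ j", OF _ _ _ r \<delta>(1)]
      by metis
  qed
  then obtain N where N: "\<And>i j. poly2 (N i j)" "\<And>i j x y. cmod x \<le> r \<Longrightarrow> cmod y \<le> r \<Longrightarrow>
      cmod (F (?\<theta> (x, y)) $ i $ j - N i j (?\<theta> (x, y))) \<le> \<delta>"
    by metis
  \<comment> \<open>The invariants are homogeneous of degrees \<open>m\<close> and
    \<open>2 * (m div t)\<close>, so dilating \<open>(x, y)\<close> by \<open>r\<close> scales them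
    separately. Thus \<open>H\<close> is polynomial in \<open>p\<close> and controlled on the whole
    closed bidisc, although \<open>N\<close> is controlled only up to radius
    \<open>r\<close>.\<close>
  define H :: "complex \<times> complex \<Rightarrow> complex^'n^'n" where
    "H p = (\<chi> i j. N i j (of_real r ^ m * fst p, of_real r ^ (2 * (m div t)) * snd p))" for p
  have H: "poly2 (\<lambda>p. H p $ i $ j)" for i j
    unfolding H_def using poly2_compose_scale[OF N(1)] by simp
  have H\<theta>: "H (?\<theta> (x, y)) $ i $ j = N i j (?\<theta> (of_real r * x, of_real r * y))" for x y i j
    by (simp add: H_def basic_map_Pair power_mult_distrib power_mult algebra_simps power2_eq_square)
  have rx: "cmod (of_real r * x) \<le> r" if "cmod x \<le> 1" for x
    using that r by (simp add: norm_mult mult_left_le)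
  have HF: "norm ((H (?\<theta> (x, y)) - F (?\<theta> (of_real r * x, of_real r * y))) *v v) \<le> \<eta> * norm v"
    if "cmod x \<le> 1" "cmod y \<le> 1" for x y v
  proof -
    have "cmod ((H (?\<theta> (x, y)) - F (?\<theta> (of_real r * x, of_real r * y))) $ i $ j) \<le> \<delta>" for i j
      using N(2)[OF rx[OF that(1)] rx[OF that(2)], of i j] by (simp add: H\<theta> norm_minus_commute)
    from matrix_vector_norm_le[OF this, of v] show ?thesis by (simp add: \<delta>(2)[symmetric] nn_def)
  qed
  have rX: "?\<theta> (of_real r * x, of_real r * y) \<in> theta_bidisc m t" if "cmod x \<le> 1" "cmod y \<le> 1" for x y
    using rx[OF that(1)] rx[OF that(2)] r by (intro inX) auto
  have Hpos: "c * (norm v)\<^sup>2 \<le> inner v (H (?\<theta> (x, y)) *v v)" if xy: "cmod x \<le> 1" "cmod y \<le> 1" for x y v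
  proof -
    let ?F = "F (?\<theta> (of_real r * x, of_real r * y))" and ?H = "H (?\<theta> (x, y))"
    have "2 * c * (norm v)\<^sup>2 \<le> inner v (?F *v v)"
    proof -
      have "2 * c = (1 - r\<^sup>2) / 4" by (simp add: c_def)
      then show ?thesis using cayley_contraction(1)[OF contr[OF rX[OF xy]] r, of v] by (simp only: F_def)
    qed
    moreover have "\<bar>inner v ((?H - ?F) *v v)\<bar> \<le> norm v * (\<eta> * norm v)"
      by (rule order_trans[OF Cauchy_Schwarz_ineq2 mult_left_mono[OF HF[OF xy]]]) simp
    moreover have "norm v * (\<eta> * norm v) \<le> c * (norm v)\<^sup>2"
      using mult_right_mono[OF \<eta>(2), of "(norm v)\<^sup>2"] by (simp add: power2_eq_square mult_ac)
    ultimately show ?thesis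
      by (simp add: matrix_vector_mult_diff_rdistrib inner_diff_right)
  qed
  have Hacc: "accretive (H (?\<theta> (x, y)))" if "cmod x \<le> 1" "cmod y \<le> 1" for x y
    unfolding accretive_def using Hpos[OF that] c by (meson mult_nonneg_nonneg less_imp_le order_trans zero_le_power2)
  have Facc: "accretive (F (?\<theta> (of_real r * x, of_real r * y)))" if xy: "cmod x \<le> 1" "cmod y \<le> 1" for x y
    unfolding accretive_def F_def
  proof
    fix v :: "complex^'n"
    have "0 \<le> (1 - r\<^sup>2) / 4 * (norm v)\<^sup>2" using c by (simp add: c_def)
    also have "\<dots> \<le> inner v (cayley (r *\<^sub>R f (?\<theta> (of_real r * x, of_real r * y))) *v v)"
      by (intro cayley_contraction(1) contr rX xy r)
    finally show "0 \<le> inner v (cayley (r *\<^sub>R f (?\<theta> (of_real r * x, of_real r * y))) *v v)" .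
  qed
  obtain M and J :: "complex \<times> complex \<Rightarrow> complex^'n^'n" where J: "\<And>i j. poly2 (\<lambda>p. J p $ i $ j)"
    and JM: "\<And>p. cmod (snd p) = 1 \<Longrightarrow> cnj (fst p) * snd p ^ t = fst p \<Longrightarrow>
       J p = cscale (snd p ^ M) (mat_adj (H p))"
    using poly2_matrix_reflection[of H t, OF H] by metis
  have cpt: "compact (?\<theta> ` (cball 0 1 \<times> cball 0 1))"
    by (intro compact_continuous_image continuous_on_basic_map compact_Times) auto
  obtain C1 C2 where C1: "C1 > 0" "\<And>p i j. p \<in> ?\<theta> ` (cball 0 1 \<times> cball 0 1) \<Longrightarrow> cmod (H p $ i $ j) \<le> C1"
    and C2: "C2 > 0" "\<And>p i j. p \<in> ?\<theta> ` (cball 0 1 \<times> cball 0 1) \<Longrightarrow> cmod (J p $ i $ j) \<le> C2"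
    using poly2_matrix_bounded[of H, OF H cpt] poly2_matrix_bounded[of J, OF J cpt] by metis
  \<comment> \<open>On the image of the polydisc of radius \<open>s\<close>, both terms of
    \<open>K - H\<close> carry a factor \<open>s ^ k\<close>, and \<open>1 - w\<close> has modulus
    at least \<open>1 - s\<close>.\<close>
  have "(\<lambda>k. s ^ k * (C1 + C2) / (1 - s)) \<longlonglongrightarrow> 0 * (C1 + C2) / (1 - s)"
    using s by (intro tendsto_intros LIMSEQ_power_zero) auto
  then have "eventually (\<lambda>k. s ^ k * (C1 + C2) / (1 - s) < \<delta>) sequentially"
    using \<delta>(1) by (simp add: order_tendsto_iff)
  then obtain k where k: "k > 0" "s ^ k * (C1 + C2) / (1 - s) < \<delta>"
    using eventually_conj[OF _ eventually_gt_at_top[of 0]] eventually_sequentially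
    by (metis (no_types, lifting) order_refl)
  \<comment> \<open>\<open>M\<close> clears the denominators of the adjoint and \<open>k\<close> is
    the free parameter; on the boundary \<open>snd p ^ k\<close> times \<open>J p\<close> is
    \<open>w p\<close> times the adjoint of \<open>H p\<close>.\<close>
  define w where "w p = snd p ^ (M + k)" for p :: "complex \<times> complex"
  define L where "L p = H p + cscale (snd p ^ k) (J p)" for p
  define \<Phi> where "\<Phi> p = (cscale (1 - w p) (mat 1) - L p) ** matrix_inv (cscale (1 - w p) (mat 1) + L p)" for p
  define K where "K p = cscale (1 / (1 - w p)) (L p)" for p
  have poly: "poly2 (\<lambda>p. (cscale (1 - w p) (mat 1) - L p) $ i $ j)"
    "poly2 (\<lambda>p. (cscale (1 - w p) (mat 1) + L p) $ i $ j)" for i j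
    unfolding w_def L_def cscale_def by (simp_all, intro poly2_intros H J, intro poly2_intros H J)
  have wX: "cmod (w (?\<theta> (x, y))) \<le> u" if "cmod x \<le> u" "cmod y \<le> u" "u \<le> 1" for x y u
  proof -
    have "cmod (snd (?\<theta> (x, y))) \<le> u" by (rule snd_basic_map_norm_le[OF t(1,3) that])
    then have "cmod (w (?\<theta> (x, y))) \<le> u ^ (M + k)" by (simp add: w_def norm_power power_mono)
    also have "\<dots> \<le> u ^ 1"
      using k that order_trans[OF norm_ge_zero that(1)] by (intro power_decreasing) auto
    finally show ?thesis by simp
  qed
  have w1: "1 - w p \<noteq> 0" if p: "p \<in> theta_bidisc m t" for p
  proof -
    obtain x y where xy: "p = ?\<theta> (x, y)" "cmod x < 1" "cmod y < 1" using p by (auto simp: theta_bidisc_def)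
    then have "cmod (w p) \<le> max (cmod x) (cmod y)" unfolding xy(1) by (intro wX) auto
    then show ?thesis using xy by auto
  qed
  have Kacc: "accretive (K p)" if p: "p \<in> theta_bidisc m t" for p
    unfolding K_def w_def L_def
    by (rule reflected_quotient_accretive[OF t(1,3) k(1) H J _ _ p])
      (auto intro!: JM Hacc basic_map_torus[OF t(1)])
  note cc = cayley_cscale[OF w1 Kacc[unfolded K_def]]
  have "rational_map_on (theta_bidisc m t) \<Phi>"
    unfolding \<Phi>_def by (rule rational_map_on_quotient[OF poly cc(1)])
  \<comment> \<open>Strict positivity of \<open>H\<close> keeps the denominator invertible even
    where \<open>w p = 1\<close>, so unitarity holds at every boundary point.\<close>
  moreover have "mat_adj (\<Phi> p) ** \<Phi> p = mat 1" if p: "p \<in> theta_boundary m t" for p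
  proof -
    obtain x y where xy: "p = ?\<theta> (x, y)" "cmod x = 1" "cmod y = 1" using p by (auto simp: theta_boundary_def)
    note tor = basic_map_torus[OF t(1) xy(2,3), folded xy(1)]
    have w: "w p * cnj (w p) = 1"
      using tor(1) complex_norm_square[of "w p"] by (simp add: w_def norm_power)
    have L: "L p = H p + cscale (w p) (mat_adj (H p))"
      unfolding L_def JM[OF tor] w_def by (simp add: cscale_def power_add mult_ac)
    have "invertible (cscale (1 - w p) (mat 1) + L p)"
      unfolding L by (rule torus_denominator_invertible[OF w c]) (use xy in \<open>auto intro: Hpos\<close>)
    then show ?thesis unfolding \<Phi>_def by (rule unitary_quotient[OF w L])
  qed
  ultimately have inner: "rational_inner m t \<Phi>"
    by (simp add: rational_inner_def)
  have "norm (\<Phi> p - f p) \<le> \<epsilon>" if p: "p \<in> ?\<theta> ` (cball 0 s \<times> cball 0 s)" for p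
  proof -
    obtain x y where xy: "p = ?\<theta> (x, y)" "cmod x \<le> s" "cmod y \<le> s" using p by auto
    have xy1: "cmod x \<le> 1" "cmod y \<le> 1" using xy s by auto
    have pX: "p \<in> theta_bidisc m t" unfolding xy(1) using xy s by (intro inX) auto
    have p1: "p \<in> ?\<theta> ` (cball 0 1 \<times> cball 0 1)" using xy xy1 by auto
    let ?G = "F (?\<theta> (of_real r * x, of_real r * y))"
    have "cmod ((K p - H p) $ i $ j) \<le> \<delta>" for i j
    proof -
      have "(K p - H p) $ i $ j = (w p * H p $ i $ j + snd p ^ k * J p $ i $ j) / (1 - w p)"
        using w1[OF pX] by (simp add: K_def L_def cscale_def field_simps)
      also have "cmod \<dots> \<le> (s ^ k * C1 + s ^ k * C2) / (1 - s)"
        unfolding norm_divide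
      proof (rule frac_le)
        have q: "cmod (snd p) \<le> s"
          unfolding xy(1) using s xy by (intro snd_basic_map_norm_le[OF t(1,3)]) auto
        have "cmod (w p) \<le> s ^ (M + k)" using q by (simp add: w_def norm_power power_mono)
        also have "\<dots> \<le> s ^ k" using s by (intro power_decreasing) auto
        finally have "cmod (w p * H p $ i $ j) \<le> s ^ k * C1"
          unfolding norm_mult using C1(2)[OF p1] s by (intro mult_mono) auto
        moreover have "cmod (snd p ^ k * J p $ i $ j) \<le> s ^ k * C2"
          unfolding norm_mult norm_power using C2(2)[OF p1] s q by (intro mult_mono power_mono) auto
        ultimately show "cmod (w p * H p $ i $ j + snd p ^ k * J p $ i $ j) \<le> s ^ k * C1 + s ^ k * C2"
          by (rule norm_triangle_mono)
        have "cmod (w p) \<le> s" unfolding xy(1) using xy s by (intro wX) auto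
        then show "1 - s \<le> cmod (1 - w p)" using norm_triangle_ineq2[of 1 "w p"] by simp
      qed (use s C1 C2 in auto)
      also have "\<dots> \<le> \<delta>" using k by (simp add: algebra_simps)
      finally show ?thesis .
    qed
    from matrix_vector_norm_le[OF this]
    have KH: "norm ((K p - H p) *v v) \<le> \<eta> * norm v" for v by (simp add: \<delta>(2)[symmetric] nn_def)
    have "norm ((\<Phi> p - r *\<^sub>R f (?\<theta> (of_real r * x, of_real r * y))) *v v) \<le> 4 * \<eta> * norm v" for v
    proof -
      have "\<Phi> p = cayley (K p)" unfolding \<Phi>_def K_def by (rule cc(2)[OF pX pX])
      moreover have "r *\<^sub>R f (?\<theta> (of_real r * x, of_real r * y)) = cayley ?G"
        unfolding F_def by (rule cayley_contraction(3)[symmetric]) (intro contr rX xy1 r)+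
      ultimately have "(\<Phi> p - r *\<^sub>R f (?\<theta> (of_real r * x, of_real r * y))) *v v =
          (cayley (K p) - cayley (H p)) *v v + (cayley (H p) - cayley ?G) *v v"
        by (simp add: matrix_vector_mult_diff_rdistrib)
      also have "norm \<dots> \<le> 2 * \<eta> * norm v + 2 * \<eta> * norm v"
        using xy1 by (intro norm_triangle_mono cayley_lipschitz Kacc pX KH) (auto simp: xy(1) intro: Hacc Facc HF)
      finally show ?thesis by simp
    qed
    then have "cmod ((\<Phi> p - r *\<^sub>R f (?\<theta> (of_real r * x, of_real r * y))) $ i $ j) \<le> 4 * \<eta>" for i j
      by (rule matrix_component_le)
    then have "norm (\<Phi> p - r *\<^sub>R f (?\<theta> (of_real r * x, of_real r * y))) \<le> nn * (4 * \<eta>)"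
      unfolding nn_def by (rule norm_matrix_le)
    from norm_triangle_mono[OF order_trans[OF this \<eta>\<epsilon>] dil[OF xy(2,3)]]
    show ?thesis by (simp add: xy(1))
  qed
  with inner show ?thesis by blast
qed

theorem theorem5p6:
  fixes m t :: nat
    and f :: "complex \<times> complex \<Rightarrow> complex^'n^'n"
  assumes "m > 0" and "t > 0" and "t dvd m"
    and "holomorphic2_on f (theta_bidisc m t)"
    and "f \<in> schur_agler (theta_bidisc m t) (Psi t)"
  shows "\<exists>\<Phi> :: nat \<Rightarrow> complex \<times> complex \<Rightarrow> complex^'n^'n.
           (\<forall>n. rational_inner m t (\<Phi> n)) \<and>
           (\<forall>K. compact K \<and> K \<subseteq> theta_bidisc m t \<longrightarrow> uniform_limit K \<Phi> f sequentially)"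
proof -
  have contr: "norm (f p *v v) \<le> norm v" if "p \<in> theta_bidisc m t" for p v
    by (rule schur_agler_contraction[OF assms(5) that]) (rule psi_norm_le[OF assms(3) that])
  \<comment> \<open>\<open>Suc (Suc n)\<close> makes the first radius \<open>1/2\<close>, so all are
    positive; as they increase to 1, every compact subset is eventually covered.\<close>
  define s where "s n = 1 - inverse (real (Suc (Suc n)))" for n
  have s: "0 < s n" "s n < 1" for n by (auto simp: s_def field_simps)
  have "\<forall>n. \<exists>\<Phi>. rational_inner m t \<Phi> \<and>
      (\<forall>p\<in>basic_map m t ` (cball 0 (s n) \<times> cball 0 (s n)). norm (\<Phi> p - f p) \<le> inverse (real (Suc n)))"
    using rational_inner_approximation_on_polydisc[OF assms(3,2,1,4) contr s] by simp
  then obtain \<Phi> where \<Phi>: "\<And>n. rational_inner m t (\<Phi> n)"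
    "\<And>n p. p \<in> basic_map m t ` (cball 0 (s n) \<times> cball 0 (s n)) \<Longrightarrow> norm (\<Phi> n p - f p) \<le> inverse (real (Suc n))"
    by metis
  have "uniform_limit K \<Phi> f sequentially" if K: "compact K" "K \<subseteq> theta_bidisc m t" for K
  proof (rule uniform_limitI)
    fix e :: real assume e: "e > 0"
    obtain u where u: "u < 1" "K \<subseteq> basic_map m t ` (cball 0 u \<times> cball 0 u)"
      using compact_subset_theta_bidisc[OF assms(3,1) K] by blast
    have "s \<longlonglongrightarrow> 1 - 0"
      unfolding s_def by (intro tendsto_intros LIMSEQ_Suc[OF LIMSEQ_inverse_real_of_nat])
    then have "eventually (\<lambda>n. u < s n) sequentially" using u by (simp add: order_tendsto_iff)
    moreover have "eventually (\<lambda>n. inverse (real (Suc n)) < e) sequentially"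
      using LIMSEQ_inverse_real_of_nat e by (simp add: order_tendsto_iff)
    ultimately show "\<forall>\<^sub>F n in sequentially. \<forall>p\<in>K. dist (\<Phi> n p) (f p) < e"
    proof eventually_elim
      case (elim n)
      show ?case
      proof
        fix p assume "p \<in> K"
        then have "p \<in> basic_map m t ` (cball 0 (s n) \<times> cball 0 (s n))" using u elim by force
        from \<Phi>(2)[OF this] elim show "dist (\<Phi> n p) (f p) < e" by (simp add: dist_norm)
      qed
    qed
  qed
  with \<Phi>(1) show ?thesis by blast
qed

end
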